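(* Let $X$ be a locally compact topological space homeomorphic to a subspace of a manifold. Let $\Phi$ be a $C^0$ flow on $X$ with a globally asymptotically stable periodic orbit with image $A\subset X$. Then $(X,\Phi)$ is linearizable by a $C^0$ embedding if and only if $A$ has $C^0$ asymptotic phase.
   Context: Manifolds are, as usual, finite-dimensional, Hausdorff, second countable and without boundary. $C^0$ means continuous. A flow on $X$ is a group action $\Phi\colon \mathbb{R}\times X\to X$, $(t,x)\mapsto \Phi^t(x)$, of $(\mathbb{R},+)$ on $X$; it is $C^0$ if $\Phi$ is continuous. The image of a periodic orbit $t\mapsto\Phi^t(x_0)$ is the compact invariant set $A=\{\Phi^t(x_0)\colon t\in\mathbb{R}\}$. It is globally asymptotically stable if every neighborhood $U$ of $A$ contains a neighborhood $V$ of $A$ with $\Phi^t(V)\subset U$ for all $t\geq 0$, and $\Phi^t(x)\to A$ as $t\to\infty$ for every $x\in X$ (i.e. $\Phi^t(x)$ is eventually in every neighborhood of $A$). $A$ has $C^0$ asymptotic phase if there is a continuous map $P\colon X\to A$ with $P|_A=\mathrm{id}_A$ and $P\circ\Phi^t=\Phi^t\circ P$ for all $t\in\mathbb{R}$. A map $F\colon X\to\mathbb{R}^n$ is linearizing (for $\Phi$) if there is a matrix $B\in\mathbb{R}^{n\times n}$ such that $F\circ\Phi^t=e^{Bt}\circ F$ for all $t\in\mathbb{R}$. A $C^0$ embedding is a homeomorphism onto its image (with the subspace topology). $(X,\Phi)$ is linearizable by a $C^0$ embedding if for some $n\in\mathbb{N}$ there is a linearizing $C^0$ embedding $F\colon X\to\mathbb{R}^n$.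 *)

theory Defs
  imports "HOL-Analysis.Analysis" "Jordan_Normal_Form.Matrix"
begin

definition manifold :: "'a topology \<Rightarrow> bool" where
  "manifold M \<longleftrightarrow>
     Hausdorff_space M \<and> second_countable M \<and>
     (\<exists>n. \<forall>p \<in> topspace M. \<exists>U V.
        openin M U \<and> p \<in> U \<and> openin (Euclidean_space n) V \<and>
        subtopology M U homeomorphic_space subtopology (Euclidean_space n) V)"

definition C0_flow :: "'a topology \<Rightarrow> (real \<Rightarrow> 'a \<Rightarrow> 'a) \<Rightarrow> bool" where
  "C0_flow X \<Phi> \<longleftrightarrow>
     continuous_map (prod_topology euclideanreal X) X (\<lambda>(t, x). \<Phi> t x) \<and>
     (\<forall>x \<in> topspace X. \<Phi> 0 x = x) \<and>
     (\<forall>s t. \<forall>x \<in> topspace X. \<Phi> (s + t) x = \<Phi> s (\<Phi> t x))"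

(* Constant orbits are not excluded: no minimality or nonconstancy is imposed on the period. *)
definition periodic_orbit_image :: "'a topology \<Rightarrow> (real \<Rightarrow> 'a \<Rightarrow> 'a) \<Rightarrow> 'a set \<Rightarrow> bool" where
  "periodic_orbit_image X \<Phi> A \<longleftrightarrow>
     (\<exists>x0 \<in> topspace X. (\<exists>T>0. \<forall>t. \<Phi> (t + T) x0 = \<Phi> t x0) \<and> A = range (\<lambda>t. \<Phi> t x0))"

(* Neighborhoods need not be open. *)
definition set_nhd :: "'a topology \<Rightarrow> 'a set \<Rightarrow> 'a set \<Rightarrow> bool" where
  "set_nhd X A U \<longleftrightarrow> U \<subseteq> topspace X \<and> (\<exists>W. openin X W \<and> A \<subseteq> W \<and> W \<subseteq> U)"

definition globally_asymptotically_stable ::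
    "'a topology \<Rightarrow> (real \<Rightarrow> 'a \<Rightarrow> 'a) \<Rightarrow> 'a set \<Rightarrow> bool" where
  "globally_asymptotically_stable X \<Phi> A \<longleftrightarrow>
     (\<forall>U. set_nhd X A U \<longrightarrow> (\<exists>V. set_nhd X A V \<and> V \<subseteq> U \<and> (\<forall>t\<ge>0. \<Phi> t ` V \<subseteq> U))) \<and>
     (\<forall>x \<in> topspace X. \<forall>U. set_nhd X A U \<longrightarrow> (\<forall>\<^sub>F t in at_top. \<Phi> t x \<in> U))"

definition has_C0_asymptotic_phase ::
    "'a topology \<Rightarrow> (real \<Rightarrow> 'a \<Rightarrow> 'a) \<Rightarrow> 'a set \<Rightarrow> bool" where
  "has_C0_asymptotic_phase X \<Phi> A \<longleftrightarrow>
     (\<exists>P. continuous_map X (subtopology X A) P \<and>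
          (\<forall>a \<in> A. P a = a) \<and>
          (\<forall>t. \<forall>x \<in> topspace X. P (\<Phi> t x) = \<Phi> t (P x)))"

(* The exponential series, summed entrywise; it converges absolutely for every square matrix. *)
definition mat_exp :: "real mat \<Rightarrow> real mat" where
  "mat_exp A = mat (dim_row A) (dim_row A) (\<lambda>(i, j). \<Sum>k. (A ^\<^sub>m k) $$ (i, j) / fact k)"

(* Points of R^n are the elements of topspace (Euclidean_space n), i.e. functions nat => real
   vanishing at all indices >= n; vec n turns them into column vectors for matrix multiplication. *)
definition linearizing ::
    "'a topology \<Rightarrow> (real \<Rightarrow> 'a \<Rightarrow> 'a) \<Rightarrow> nat \<Rightarrow> ('a \<Rightarrow> nat \<Rightarrow> real) \<Rightarrow> bool" where
  "linearizing X \<Phi> n F \<longleftrightarrow>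
     F \<in> topspace X \<rightarrow> topspace (Euclidean_space n) \<and>
     (\<exists>B \<in> carrier_mat n n. \<forall>t. \<forall>x \<in> topspace X.
        vec n (F (\<Phi> t x)) = mat_exp (t \<cdot>\<^sub>m B) *\<^sub>v vec n (F x))"

definition linearizable_by_C0_embedding ::
    "'a topology \<Rightarrow> (real \<Rightarrow> 'a \<Rightarrow> 'a) \<Rightarrow> bool" where
  "linearizable_by_C0_embedding X \<Phi> \<longleftrightarrow>
     (\<exists>n F. linearizing X \<Phi> n F \<and> embedding_map X (Euclidean_space n) F)"

end

theory Submission
  imports Defs
begin

text \<open>
  Linearizable implies phase. In linear coordinates \<open>F\<close> the point \<open>F (\<Phi> t x)\<close> is a linear function of
  \<open>F x\<close>, so every trajectory is a fixed combination of finitely many trajectories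
  (\<open>finite_spanning_coordinates\<close>). All forward trajectories are bounded because they are attracted by the
  compact orbit; hence the maps \<open>\<Phi> t\<close> with \<open>t \<ge> 0\<close> are Lipschitz with one common constant for the distance
  read off in \<open>F\<close> (\<open>forward_bounded_linear_flow_lipschitz\<close>). If \<open>T\<close> is a period, then \<open>\<Phi> T\<close> fixes \<open>A\<close>
  pointwise. Some iterate of \<open>\<Phi> T\<close> brings \<open>x\<close> close to a point of \<open>A\<close>, and by the common Lipschitz constant
  all later iterates stay close to that point. So the iterates converge to a point \<open>P x\<close> of \<open>A\<close>, and \<open>P\<close>
  inherits the Lipschitz bound and the equivariance: it is an asymptotic phase.

  Phase implies linearizable. Off the attractor there is a continuous function \<open>\<tau>\<close> that decreases at unit
  speed along the flow, tends to \<open>- \<infinity>\<close> at \<open>A\<close> and has relatively compact sublevel sets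
  (\<open>time_to_section\<close>); it measures the time spent far from \<open>A\<close>. Thus \<open>V = exp \<tau>\<close>, extended by \<open>0\<close>, is a
  proper function with \<open>V (\<Phi> t x) = exp (- t) * V x\<close>, and \<open>K = {\<tau> = 0}\<close> is a compact cross section. Being a
  compact subset of a manifold, \<open>K\<close> is separated by finitely many real functions \<open>g\<close>. Transporting \<open>g\<close>
  along the flow and damping it by \<open>V\<close> gives coordinates \<open>V x * g (\<Phi> (\<tau> x) x)\<close> that also contract
  at rate one and extend continuously by \<open>0\<close> to \<open>A\<close> because \<open>g\<close> is bounded
  (\<open>contracting_coordinates\<close>). These coordinates separate all points off \<open>A\<close> and vanish on \<open>A\<close>. On \<open>A\<close> a
  rotating complex coordinate \<open>\<theta>\<close> is injective (\<open>periodic_orbit_circle_coordinate\<close>), and the phase \<open>P\<close>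
  spreads it over the whole space as \<open>\<theta> (P x)\<close>. Together they form an injective proper continuous map that
  intertwines the flow with the exponential of a rotation block and \<open>- 1\<close> on the diagonal.
\<close>

section \<open>Continuity and compactness in abstract topological spaces\<close>

lemma continuous_map_eps_nhdI:
  fixes f :: "'a \<Rightarrow> 'b::metric_space"
  assumes "\<And>x e. \<lbrakk>x \<in> topspace X; 0 < e\<rbrakk> \<Longrightarrow> \<exists>U. openin X U \<and> x \<in> U \<and> (\<forall>y\<in>U. dist (f x) (f y) < e)"
  shows "continuous_map X euclidean f"
  using Met_TC.continuous_map_to_metric[of X f] assms by auto

lemma continuous_map_eps_nhdD:
  fixes f :: "'a \<Rightarrow> 'b::metric_space"
  assumes "continuous_map X euclidean f" "x \<in> topspace X" "0 < e"
  obtains U where "openin X U" "x \<in> U" "\<And>y. y \<in> U \<Longrightarrow> dist (f x) (f y) < e"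
  using Met_TC.continuous_map_to_metric[of X f] assms that by simp metis

lemma openin_real_less:
  fixes f :: "'a \<Rightarrow> real"
  assumes "continuous_map X euclideanreal f"
  shows "openin X {x \<in> topspace X. f x < c}" "openin X {x \<in> topspace X. c < f x}"
  using openin_continuous_map_preimage[OF assms, of "{..<c}"]
    openin_continuous_map_preimage[OF assms, of "{c<..}"] by auto

lemma closedin_real_le:
  fixes f :: "'a \<Rightarrow> real"
  assumes "continuous_map X euclideanreal f"
  shows "closedin X {x \<in> topspace X. f x \<le> c}" "closedin X {x \<in> topspace X. f x = c}"
  using closedin_continuous_map_preimage[OF assms, of "{..c}"]
    closedin_continuous_map_preimage[OF assms, of "{c}"] by auto

text \<open>
  The tube lemma: the complement is the projection of a closed set along a compact factor.
\<close>

lemma openin_forall_compact: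
  assumes W: "openin (prod_topology Y X) W" and K: "compactin Y K"
  shows "openin X {x \<in> topspace X. \<forall>s\<in>K. (s, x) \<in> W}"
proof -
  let ?K = "subtopology Y K"
  have sub: "K \<subseteq> topspace Y"
    using K by (simp add: compactin_subset_topspace)
  have "openin (prod_topology ?K X) (W \<inter> (K \<times> topspace X))"
    using openin_subtopology_Int[OF W] sub
    by (simp add: prod_topology_subtopology(1))
  moreover have "(K \<times> topspace X) - ((K \<times> topspace X) - W) = W \<inter> (K \<times> topspace X)"
    by blast
  ultimately have "closedin (prod_topology ?K X) ((K \<times> topspace X) - W)"
    using sub by (auto simp: closedin_def Int_absorb1)
  moreover have "compact_space ?K"
    using K by (simp add: compact_space_subtopology)
  ultimately have "closedin X (snd ` ((K \<times> topspace X) - W))"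
    using closed_map_snd closed_map_def by blast
  then have "openin X (topspace X - snd ` ((K \<times> topspace X) - W))"
    by blast
  moreover have "topspace X - snd ` ((K \<times> topspace X) - W) = {x \<in> topspace X. \<forall>s\<in>K. (s, x) \<in> W}"
    by (force simp: image_iff)
  ultimately show ?thesis by simp
qed

text \<open>
  Continuity at \<open>x\<close> asks that \<open>u s y\<close> be uniformly close to \<open>u s x\<close> for all \<open>s\<close> in the compact interval;
  the tube lemma provides such a neighbourhood of \<open>x\<close>.
\<close>

lemma continuous_map_integral_parameter:
  fixes u :: "real \<Rightarrow> 'a \<Rightarrow> real"
  assumes u: "continuous_map (prod_topology euclideanreal X) euclideanreal (\<lambda>(s, x). u s x)"
  shows "continuous_map X euclideanreal (\<lambda>x. integral {a..b} (\<lambda>s. u s x))"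
proof (rule continuous_map_eps_nhdI)
  fix x and e :: real
  assume x: "x \<in> topspace X" and "0 < e"
  \<comment> \<open>The interval has length at most \<open>\<bar>b - a\<bar>\<close>; the summand \<open>1\<close> and the factor \<open>2\<close> make the final bound strict.\<close>
  define d where "d = e / (2 * (\<bar>b - a\<bar> + 1))"
  have d: "d > 0" using \<open>0 < e\<close> by (simp add: d_def add_nonneg_pos)
  have cs: "continuous_on UNIV (\<lambda>s. u s y)" if "y \<in> topspace X" for y
  proof -
    have "continuous_map euclideanreal (prod_topology euclideanreal X) (\<lambda>s. (s, y))"
      using that by (auto simp: continuous_map_pairedI)
    from continuous_map_compose[OF this u] show ?thesis
      by (simp add: o_def)
  qed
  then have int: "(\<lambda>s. u s y) integrable_on {a..b}" if "y \<in> topspace X" for y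
    using that by (meson continuous_on_subset integrable_continuous_interval top_greatest)
  have "continuous_map (prod_topology euclideanreal X) euclideanreal (\<lambda>p. u (fst p) (snd p) - u (fst p) x)"
  proof (intro continuous_intros)
    show "continuous_map (prod_topology euclideanreal X) euclideanreal (\<lambda>p. u (fst p) (snd p))"
      using u by (simp add: case_prod_unfold)
    show "continuous_map (prod_topology euclideanreal X) euclideanreal (\<lambda>p. u (fst p) x)"
      using continuous_map_of_fst[of euclideanreal X euclideanreal "\<lambda>s. u s x"] cs[OF x]
      by (simp add: o_def)
  qed
  then have "continuous_map (prod_topology euclideanreal X) euclideanreal (\<lambda>p. \<bar>u (fst p) (snd p) - u (fst p) x\<bar>)"
    by (rule continuous_map_real_abs)
  from openin_real_less(1)[OF this, of d]
  have "openin X {y \<in> topspace X. \<forall>s\<in>{a..b}. (s, y) \<in> {p \<in> topspace (prod_topology euclideanreal X). \<bar>u (fst p) (snd p) - u (fst p) x\<bar> < d}}"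
    by (rule openin_forall_compact) auto
  moreover have "x \<in> {y \<in> topspace X. \<forall>s\<in>{a..b}. (s, y) \<in> {p \<in> topspace (prod_topology euclideanreal X). \<bar>u (fst p) (snd p) - u (fst p) x\<bar> < d}}"
    using x d by auto
  moreover have "dist (integral {a..b} (\<lambda>s. u s x)) (integral {a..b} (\<lambda>s. u s y)) < e"
    if y: "y \<in> {y \<in> topspace X. \<forall>s\<in>{a..b}. (s, y) \<in> {p \<in> topspace (prod_topology euclideanreal X). \<bar>u (fst p) (snd p) - u (fst p) x\<bar> < d}}" for y
  proof -
    have y': "y \<in> topspace X" "\<And>s. s \<in> {a..b} \<Longrightarrow> \<bar>u s x - u s y\<bar> \<le> d"
      using y by (auto simp: abs_minus_commute less_imp_le)
    have "\<bar>integral {a..b} (\<lambda>s. u s x) - integral {a..b} (\<lambda>s. u s y)\<bar> = \<bar>integral {a..b} (\<lambda>s. u s x - u s y)\<bar>"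
      by (simp add: integral_diff int x y'(1))
    also have "\<dots> \<le> d * \<bar>b - a\<bar>"
    proof (cases "a \<le> b")
      case True
      have "norm (integral {a..b} (\<lambda>s. u s x - u s y)) \<le> d * (b - a)"
        by (rule integral_bound) (use True y' cs x in \<open>auto intro!: continuous_intros intro: continuous_on_subset\<close>)
      then show ?thesis using True by simp
    next
      case False
      then show ?thesis using d by simp
    qed
    also have "\<dots> < d * (2 * (\<bar>b - a\<bar> + 1))" using d by (simp add: mult_strict_left_mono)
    also have "\<dots> = e"
    proof -
      have "2 * (\<bar>b - a\<bar> + 1) > 0" by (intro mult_pos_pos add_nonneg_pos) auto
      then show ?thesis unfolding d_def by (metis less_irrefl nonzero_eq_divide_eq)
    qed
    finally show ?thesis by (simp add: dist_real_def)
  qed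
  ultimately show "\<exists>U. openin X U \<and> x \<in> U \<and> (\<forall>y\<in>U. dist (integral {a..b} (\<lambda>s. u s x)) (integral {a..b} (\<lambda>s. u s y)) < e)"
    by (intro exI conjI ballI)
qed

section \<open>Flows and compact attractors\<close>

lemma set_nhd_openI: "openin X U \<Longrightarrow> A \<subseteq> U \<Longrightarrow> set_nhd X A U"
  using openin_subset unfolding set_nhd_def by blast

locale continuous_flow =
  fixes X :: "'a topology" and \<Phi> :: "real \<Rightarrow> 'a \<Rightarrow> 'a"
  assumes flow: "C0_flow X \<Phi>"
begin

lemma flow_continuous: "continuous_map (prod_topology euclideanreal X) X (\<lambda>(t, x). \<Phi> t x)"
  using flow by (simp add: C0_flow_def)

lemma flow_in [simp]: "x \<in> topspace X \<Longrightarrow> \<Phi> t x \<in> topspace X"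
  using funcset_mem[OF continuous_map_funspace[OF flow_continuous], of "(t, x)"] by simp

lemma flow_0 [simp]: "x \<in> topspace X \<Longrightarrow> \<Phi> 0 x = x"
  using flow by (simp add: C0_flow_def)

lemma flow_add: "x \<in> topspace X \<Longrightarrow> \<Phi> s (\<Phi> t x) = \<Phi> (s + t) x"
  using flow by (simp add: C0_flow_def)

lemma flow_continuous_compose:
  assumes "continuous_map Y euclideanreal t" "continuous_map Y X f"
  shows "continuous_map Y X (\<lambda>y. \<Phi> (t y) (f y))"
  using continuous_map_compose[OF continuous_map_pairedI[OF assms] flow_continuous]
  by (simp add: o_def)

lemma time_map_continuous: "continuous_map X X (\<Phi> t)"
  using flow_continuous_compose[of X "\<lambda>_. t" id] by simp

lemma openin_flow_compact_times:
  assumes "compact I" "openin X U"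
  shows "openin X {x \<in> topspace X. \<forall>s\<in>I. \<Phi> s x \<in> U}"
proof -
  have "openin X {x \<in> topspace X. \<forall>s\<in>I. (s, x) \<in> {p \<in> topspace (prod_topology euclideanreal X). (case p of (t, x) \<Rightarrow> \<Phi> t x) \<in> U}}"
    using assms
    by (intro openin_forall_compact[where Y = euclideanreal] openin_continuous_map_preimage[OF flow_continuous])
      (simp_all add: compactin_euclidean_iff)
  moreover have "{x \<in> topspace X. \<forall>s\<in>I. (s, x) \<in> {p \<in> topspace (prod_topology euclideanreal X). (case p of (t, x) \<Rightarrow> \<Phi> t x) \<in> U}}
     = {x \<in> topspace X. \<forall>s\<in>I. \<Phi> s x \<in> U}"
    by auto
  ultimately show ?thesis by simp
qed

end

locale attractor = continuous_flow +
  fixes A :: "'a set"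
  assumes Hausdorff: "Hausdorff_space X"
    and locally_compact: "locally_compact_space X"
    and compact_A: "compactin X A"
    and invariant_A: "a \<in> A \<Longrightarrow> \<Phi> t a \<in> A"
    and stable: "globally_asymptotically_stable X \<Phi> A"
begin

lemma A_subset: "A \<subseteq> topspace X"
  using compact_A by (simp add: compactin_subset_topspace)

lemma flow_in_A_iff: "x \<in> topspace X \<Longrightarrow> \<Phi> t x \<in> A \<longleftrightarrow> x \<in> A"
  by (metis add.left_inverse flow_0 flow_add invariant_A)

lemma stable_nhd:
  assumes "openin X U" "A \<subseteq> U"
  obtains W where "openin X W" "A \<subseteq> W" "W \<subseteq> U" "\<And>t x. 0 \<le> t \<Longrightarrow> x \<in> W \<Longrightarrow> \<Phi> t x \<in> U"
proof -
  obtain V where V: "set_nhd X A V" "V \<subseteq> U" "\<And>t. t \<ge> 0 \<Longrightarrow> \<Phi> t ` V \<subseteq> U"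
    using stable set_nhd_openI[OF assms] unfolding globally_asymptotically_stable_def by meson
  then obtain W where "openin X W" "A \<subseteq> W" "W \<subseteq> V"
    unfolding set_nhd_def by blast
  then show ?thesis using that[of W] V by blast
qed

text \<open>
  A trajectory enters a stability neighbourhood of \<open>A\<close> at some time \<open>t0\<close>; so do the trajectories of all nearby
  points at the same time, and stability keeps them in \<open>U\<close> afterwards.
\<close>

lemma locally_uniform_attraction:
  assumes "openin X U" "A \<subseteq> U" "x \<in> topspace X"
  obtains W s0 where "openin X W" "x \<in> W" "\<And>s y. s0 \<le> s \<Longrightarrow> y \<in> W \<Longrightarrow> \<Phi> s y \<in> U"
proof -
  obtain V where V: "openin X V" "A \<subseteq> V" "V \<subseteq> U" "\<And>t x. 0 \<le> t \<Longrightarrow> x \<in> V \<Longrightarrow> \<Phi> t x \<in> U"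
    using stable_nhd[OF assms(1,2)] by metis
  have "\<forall>\<^sub>F t in at_top. \<Phi> t x \<in> V"
    using stable set_nhd_openI[OF V(1,2)] assms(3) unfolding globally_asymptotically_stable_def by blast
  then obtain t0 where t0: "\<Phi> t0 x \<in> V"
    by (meson eventually_at_top_linorder order_refl)
  let ?W = "{y \<in> topspace X. \<Phi> t0 y \<in> V}"
  have "openin X ?W"
    by (rule openin_continuous_map_preimage[OF time_map_continuous V(1)])
  moreover have "\<Phi> s y \<in> U" if "t0 \<le> s" "y \<in> ?W" for s y
    using V(4)[of "s - t0" "\<Phi> t0 y"] that by (simp add: flow_add)
  ultimately show ?thesis using that[of ?W t0] t0 assms(3) by blast
qed

lemma uniform_attraction:
  assumes "openin X U" "A \<subseteq> U" "compactin X N"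
  obtains s0 where "0 \<le> s0" "\<And>s y. s0 \<le> s \<Longrightarrow> y \<in> N \<Longrightarrow> \<Phi> s y \<in> U"
proof -
  define \<W> where "\<W> = {W. openin X W \<and> (\<exists>s0. \<forall>s\<ge>s0. \<forall>y\<in>W. \<Phi> s y \<in> U)}"
  have "N \<subseteq> \<Union>\<W>"
  proof
    fix x assume "x \<in> N"
    then have "x \<in> topspace X" using assms(3) compactin_subset_topspace by blast
    then obtain W s0 where "openin X W" "x \<in> W" "\<And>s y. s0 \<le> s \<Longrightarrow> y \<in> W \<Longrightarrow> \<Phi> s y \<in> U"
      using locally_uniform_attraction[OF assms(1,2)] by metis
    then have "W \<in> \<W>" unfolding \<W>_def by blast
    then show "x \<in> \<Union>\<W>" using \<open>x \<in> W\<close> by blast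
  qed
  moreover have "\<And>W. W \<in> \<W> \<Longrightarrow> openin X W" by (simp add: \<W>_def)
  ultimately obtain \<F> where F: "finite \<F>" "\<F> \<subseteq> \<W>" "N \<subseteq> \<Union>\<F>"
    using assms(3) unfolding compactin_def by meson
  have "\<forall>W\<in>\<F>. \<exists>s0. \<forall>s\<ge>s0. \<forall>y\<in>W. \<Phi> s y \<in> U"
    using F(2) by (auto simp: \<W>_def)
  then obtain r where r: "\<And>W s y. \<lbrakk>W \<in> \<F>; s \<ge> r W; y \<in> W\<rbrakk> \<Longrightarrow> \<Phi> s y \<in> U"
    by metis
  define s0 where "s0 = Max (insert 0 (r ` \<F>))"
  have "r W \<le> s0" if "W \<in> \<F>" for W
    using that F(1) by (simp add: s0_def)
  moreover have "0 \<le> s0" using F(1) by (simp add: s0_def)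
  ultimately show ?thesis using that[of s0] F(3) r by (meson UnionE order_trans subsetD)
qed

text \<open>
  A clamped Urysohn function is \<open>0\<close> on a whole neighbourhood of \<open>A\<close>, not just on \<open>A\<close>. This makes the
  integrals over trajectories below stop changing after a finite time.
\<close>

lemma bump_function:
  obtains h :: "'a \<Rightarrow> real" and N W
  where "continuous_map X euclideanreal h" "compactin X N" "openin X W" "A \<subseteq> W" "W \<subseteq> N"
    "\<forall>x\<in>topspace X. 0 \<le> h x \<and> h x \<le> 1" "\<forall>x\<in>topspace X - N. h x = 1" "\<forall>x\<in>W. h x = 0"
proof -
  obtain G N where GN: "openin X G" "compactin X N" "A \<subseteq> G" "G \<subseteq> N"
    using locally_compact Hausdorff compact_A
    by (meson locally_compact_space_compact_closed_compact)
  \<comment> \<open>The values run from \<open>- 1\<close> to \<open>1\<close>, so that clamping at \<open>0\<close> still leaves the value \<open>1\<close> far away.\<close>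
  have "completely_regular_space X"
    using locally_compact Hausdorff locally_compact_regular_imp_completely_regular_space by blast
  moreover have "disjnt A (topspace X - G)" "closedin X (topspace X - G)"
    using GN by (auto simp: disjnt_iff)
  ultimately obtain f where f: "continuous_map X (top_of_set {-1..1::real}) f"
      "f ` (topspace X - G) \<subseteq> {-1}" "f ` A \<subseteq> {1}"
    using Urysohn_completely_regular_compact_closed[of "-1" 1 X A "topspace X - G"] compact_A by auto
  have cf: "continuous_map X euclideanreal f" and f1: "\<And>x. x \<in> topspace X \<Longrightarrow> -1 \<le> f x"
    using f(1) by (auto simp: continuous_map_in_subtopology)
  define h where "h x = max 0 (- f x)" for x
  have ch: "continuous_map X euclideanreal h"
    unfolding h_def by (intro continuous_intros cf)
  let ?W = "{x \<in> topspace X. 0 < f x}"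
  show ?thesis
  proof
    show "openin X ?W" by (rule openin_real_less[OF cf])
    show "A \<subseteq> ?W" using f(3) A_subset by auto
    show "?W \<subseteq> N" using f(2) GN(4) by force
    show "\<forall>x\<in>?W. h x = 0" by (simp add: h_def)
    show "\<forall>x\<in>topspace X. 0 \<le> h x \<and> h x \<le> 1" using f1 by (auto simp: h_def minus_le_iff)
    show "\<forall>x\<in>topspace X - N. h x = 1"
    proof
      fix x assume "x \<in> topspace X - N"
      then have "f x = -1" using f(2) GN(4) by blast
      then show "h x = 1" by (simp add: h_def)
    qed
  qed (rule ch GN(2))+
qed

end

section \<open>The time to reach a compact cross section\<close>

text \<open>
  For a function that is \<open>1\<close> in the past and \<open>0\<close> in the future, \<open>integral {a..b} u + a\<close> is the same number for
  all windows that contain the transition. It is the position of the transition, counted with mass.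
\<close>

lemma integral_plus_left_endpoint:
  fixes u :: "real \<Rightarrow> real"
  assumes u: "continuous_on UNIV u" and ab: "a \<le> a0" "a0 \<le> b0" "b0 \<le> b"
    and 1: "\<And>s. s \<le> a0 \<Longrightarrow> u s = 1" and 0: "\<And>s. b0 \<le> s \<Longrightarrow> u s = 0"
  shows "integral {a..b} u + a = integral {a0..b0} u + a0"
proof -
  have int: "u integrable_on {x..y}" for x y
    using u by (meson continuous_on_subset integrable_continuous_interval top_greatest)
  have "integral {a..b} u = integral {a..a0} u + integral {a0..b} u"
    using ab int by (intro Henstock_Kurzweil_Integration.integral_combine[symmetric]) auto
  also have "integral {a0..b} u = integral {a0..b0} u + integral {b0..b} u"
    using ab int by (intro Henstock_Kurzweil_Integration.integral_combine[symmetric]) auto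
  also have "integral {a..a0} u = integral {a..a0} (\<lambda>_. 1)"
    using 1 by (intro integral_cong) auto
  also have "integral {b0..b} u = integral {b0..b} (\<lambda>_. 0)"
    using 0 by (intro integral_cong) auto
  finally show ?thesis using ab by simp
qed

context attractor
begin

text \<open>
  The statement on the past follows from uniform attraction of \<open>N\<close>: a point that was in \<open>N\<close> a long time ago is
  by now in any prescribed neighbourhood of \<open>A\<close>, and a neighbourhood of \<open>A\<close> can be chosen that stays away from \<open>x\<close>.
\<close>

lemma settles_locally_uniformly:
  assumes x: "x \<in> topspace X - A" and W: "openin X W" "A \<subseteq> W" and N: "compactin X N"
  obtains U T where "openin X U" "x \<in> U" "0 \<le> T"
    "\<forall>y\<in>U. \<forall>s\<ge>T. \<Phi> s y \<in> W \<and> \<Phi> (- s) y \<notin> N"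
proof -
  obtain U1 s0 where U1: "openin X U1" "x \<in> U1" "\<And>s y. s0 \<le> s \<Longrightarrow> y \<in> U1 \<Longrightarrow> \<Phi> s y \<in> W"
    using locally_uniform_attraction[OF W, of x] x by auto
  have "compactin X {x}" using x by simp
  then obtain U2 G where U2: "openin X U2" "openin X G" "{x} \<subseteq> U2" "A \<subseteq> G" "disjnt U2 G"
    using Hausdorff_space_compact_separation[OF Hausdorff _ compact_A, of "{x}"] x by auto
  obtain s1 where s1: "0 \<le> s1" "\<And>s y. s1 \<le> s \<Longrightarrow> y \<in> N \<Longrightarrow> \<Phi> s y \<in> G"
    using uniform_attraction[OF U2(2,4) N] by metis
  have past: "\<Phi> (- s) y \<notin> N" if "y \<in> U2" "s1 \<le> s" for y s
  proof
    assume "\<Phi> (- s) y \<in> N"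
    then have "\<Phi> s (\<Phi> (- s) y) \<in> G" using s1(2) that by blast
    then have "y \<in> G" using that U2(1) openin_subset by (fastforce simp: flow_add)
    then show False using that U2(5) by (auto simp: disjnt_iff)
  qed
  show ?thesis
  proof (rule that[of "U1 \<inter> U2" "max s0 s1"])
    show "openin X (U1 \<inter> U2)" using U1 U2 by blast
    show "x \<in> U1 \<inter> U2" using U1 U2 by auto
    show "0 \<le> max s0 s1" using s1 by auto
    show "\<forall>y\<in>U1 \<inter> U2. \<forall>s\<ge>max s0 s1. \<Phi> s y \<in> W \<and> \<Phi> (- s) y \<notin> N"
      using U1(3) past by auto
  qed
qed

text \<open>
  With \<open>h\<close> equal to \<open>0\<close> near \<open>A\<close> and \<open>1\<close> outside a compact set \<open>N\<close>, the function \<open>s \<mapsto> h (\<Phi> s x)\<close> is \<open>1\<close> in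
  the far past and \<open>0\<close> in the far future of every \<open>x\<close> off \<open>A\<close>. The value \<open>\<tau> x\<close> is the mass of \<open>h\<close> along the
  future minus the mass of \<open>1 - h\<close> along the past, that is, the limit of the integrals over \<open>{-T..T}\<close>
  minus \<open>T\<close>. Moving \<open>x\<close> along its trajectory translates the integrand, which changes \<open>\<tau>\<close> at unit speed.
  Near \<open>A\<close> the trajectory has been close to \<open>A\<close> for a long time, so the subtracted mass is large. Conversely,
  if \<open>\<tau> x\<close> is at most \<open>c\<close>, then the trajectory of \<open>x\<close> must meet \<open>N\<close> within a bounded time, which confines
  \<open>x\<close> to a compact set.
\<close>

proposition time_to_section:
  obtains \<tau> where "continuous_map (subtopology X (topspace X - A)) euclideanreal \<tau>"
    "\<And>t x. x \<in> topspace X - A \<Longrightarrow> \<tau> (\<Phi> t x) = \<tau> x - t"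
    "\<And>c. \<exists>U. openin X U \<and> A \<subseteq> U \<and> (\<forall>x\<in>U - A. \<tau> x < c)"
    "\<And>c. \<exists>C. compactin X C \<and> (\<forall>x\<in>topspace X - A. \<tau> x \<le> c \<longrightarrow> x \<in> C)"
proof -
  obtain h N W where h: "continuous_map X euclideanreal h" and N: "compactin X N"
    and W: "openin X W" "A \<subseteq> W" "W \<subseteq> N"
    and h01: "\<forall>x\<in>topspace X. 0 \<le> h x \<and> h x \<le> 1"
    and hN': "\<forall>x\<in>topspace X - N. h x = 1" and hW': "\<forall>x\<in>W. h x = 0"
    by (rule bump_function)
  have h0: "0 \<le> h x" and h1: "h x \<le> 1" if "x \<in> topspace X" for x using h01 that by auto
  have hN: "h x = 1" if "x \<in> topspace X" "x \<notin> N" for x using hN' that by auto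
  have hW: "h x = 0" if "x \<in> W" for x using hW' that by auto
  have "continuous_map (prod_topology euclideanreal X) euclideanreal (\<lambda>(s, x). h (\<Phi> s x))"
    using continuous_map_compose[OF flow_continuous h] by (simp add: o_def case_prod_unfold)
  then have cI: "continuous_map X euclideanreal (\<lambda>x. integral {a..b} (\<lambda>s. h (\<Phi> s x)))" for a b
    by (rule continuous_map_integral_parameter)
  have cu: "continuous_on UNIV (\<lambda>s. h (\<Phi> s x))" if "x \<in> topspace X" for x
  proof -
    have "continuous_map euclideanreal X (\<lambda>s. \<Phi> s x)"
      using flow_continuous_compose[of euclideanreal id "\<lambda>_. x"] that by simp
    from continuous_map_compose[OF this h] show ?thesis by (simp add: o_def)
  qed
  have int: "(\<lambda>s. h (\<Phi> s x)) integrable_on {a..b}" if "x \<in> topspace X" for x a b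
    using cu[OF that] by (meson continuous_on_subset integrable_continuous_interval top_greatest)
  \<comment> \<open>From the time on at which \<open>x\<close> is settled, \<open>I T x\<close> does not depend on \<open>T\<close>. Locally one \<open>T\<close> serves all
      points, so \<open>\<tau>\<close> is locally a parameter integral over a fixed interval.\<close>
  define I where "I T x = integral {-T..T} (\<lambda>s. h (\<Phi> s x)) - T" for T x
  define settled where "settled T x \<longleftrightarrow> 0 \<le> T \<and> (\<forall>s\<ge>T. h (\<Phi> s x) = 0 \<and> h (\<Phi> (- s) x) = 1)" for T x
  define \<tau> where "\<tau> x = Lim at_top (\<lambda>T. I T x)" for x
  have settled_window: "integral {a..b} (\<lambda>s. h (\<Phi> s x)) + a = I T x"
    if "settled T x" "x \<in> topspace X" "a \<le> - T" "T \<le> b" for T x a b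
  proof -
    have 1: "h (\<Phi> s x) = 1" if "s \<le> - T" for s
      using \<open>settled T x\<close> that unfolding settled_def by (metis minus_le_iff minus_minus)
    have "integral {a..b} (\<lambda>s. h (\<Phi> s x)) + a = integral {-T..T} (\<lambda>s. h (\<Phi> s x)) + - T"
      using that 1 by (intro integral_plus_left_endpoint cu) (auto simp: settled_def)
    then show ?thesis by (simp add: I_def)
  qed
  have \<tau>_eq: "\<tau> x = I T x" if "settled T x" "x \<in> topspace X" for T x
  proof -
    have "I S x = I T x" if "S \<ge> T" for S
      using settled_window[OF \<open>settled T x\<close> \<open>x \<in> topspace X\<close>, of "- S" S] that by (simp add: I_def)
    then have "\<forall>\<^sub>F S in at_top. I S x = I T x"
      unfolding eventually_at_top_linorder by blast
    then have "((\<lambda>S. I S x) \<longlongrightarrow> I T x) at_top" by (rule tendsto_eventually)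
    then show ?thesis unfolding \<tau>_def by (intro tendsto_Lim) auto
  qed
  have settled_mono: "settled S x" if "settled T x" "T \<le> S" for S T x
    using that by (auto simp: settled_def)
  have loc: "\<exists>U T. openin X U \<and> x \<in> U \<and> (\<forall>y\<in>U. settled T y)" if x: "x \<in> topspace X - A" for x
  proof -
    obtain U T where U: "openin X U" "x \<in> U" "0 \<le> T"
        "\<forall>y\<in>U. \<forall>s\<ge>T. \<Phi> s y \<in> W \<and> \<Phi> (- s) y \<notin> N"
      by (rule settles_locally_uniformly[OF x W(1,2) N])
    have "settled T y" if "y \<in> U" for y
    proof -
      have "y \<in> topspace X" using that U(1) openin_subset by blast
      then show ?thesis unfolding settled_def using U(3,4) that hN hW by simp
    qed
    then show ?thesis using U by blast
  qed
  have ex_settled: "\<exists>T\<ge>c. settled T x" if x: "x \<in> topspace X - A" for x c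
    using loc[OF x] settled_mono by (meson max.cobounded1 max.cobounded2)
  show ?thesis
  proof
    show "continuous_map (subtopology X (topspace X - A)) euclideanreal \<tau>"
    proof (rule continuous_map_eps_nhdI)
      fix x and e :: real assume "x \<in> topspace (subtopology X (topspace X - A))" and e: "0 < e"
      then have x: "x \<in> topspace X - A" by simp
      then obtain U T where U: "openin X U" "x \<in> U" "\<And>y. y \<in> U \<Longrightarrow> settled T y"
        using loc by metis
      have "continuous_map X euclideanreal (I T)"
        unfolding I_def by (intro continuous_intros cI)
      then obtain U' where U': "openin X U'" "x \<in> U'" "\<And>y. y \<in> U' \<Longrightarrow> dist (I T x) (I T y) < e"
        using continuous_map_eps_nhdD e x by (metis DiffD1)
      have "dist (\<tau> x) (\<tau> y) < e" if "y \<in> U \<inter> U'" for y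
        using that U' U openin_subset[OF U(1)] by (subst (1 2) \<tau>_eq[of T]) auto
      moreover have "openin (subtopology X (topspace X - A)) ((topspace X - A) \<inter> (U \<inter> U'))"
        using U U' by (intro openin_subtopology_Int2) blast
      ultimately show "\<exists>V. openin (subtopology X (topspace X - A)) V \<and> x \<in> V \<and> (\<forall>y\<in>V. dist (\<tau> x) (\<tau> y) < e)"
        using U(2) U'(2) x by (intro exI[of _ "(topspace X - A) \<inter> (U \<inter> U')"]) auto
    qed
  next
    fix t x assume x: "x \<in> topspace X - A"
    then obtain T where T: "settled T x" using ex_settled by blast
    \<comment> \<open>A window that is large enough for both \<open>x\<close> and \<open>\<Phi> t x\<close>.\<close>
    let ?T = "T + \<bar>t\<bar>"
    have "settled ?T (\<Phi> t x)"
      unfolding settled_def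
    proof (intro conjI allI impI)
      show "0 \<le> ?T" using T by (simp add: settled_def)
      fix s assume s: "?T \<le> s"
      show "h (\<Phi> s (\<Phi> t x)) = 0"
        using T s x unfolding settled_def by (simp add: flow_add)
      have "T \<le> - (- s + t)" using s by linarith
      then have "h (\<Phi> (- (- (- s + t))) x) = 1"
        using T unfolding settled_def by blast
      then show "h (\<Phi> (- s) (\<Phi> t x)) = 1"
        using x by (simp add: flow_add)
    qed
    then have "\<tau> (\<Phi> t x) = integral {- ?T..?T} (\<lambda>s. h (\<Phi> s (\<Phi> t x))) - ?T"
      using \<tau>_eq[of ?T "\<Phi> t x"] x by (simp add: I_def)
    also have "(\<lambda>s. h (\<Phi> s (\<Phi> t x))) = (\<lambda>s. h (\<Phi> s x)) \<circ> (+) t"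
      using x by (auto simp: flow_add add.commute)
    also have "integral {- ?T..?T} \<dots> = integral {- ?T + t..?T + t} (\<lambda>s. h (\<Phi> s x))"
    proof (rule integral_unique)
      show "((\<lambda>s. h (\<Phi> s x)) \<circ> (+) t has_integral integral {- ?T + t..?T + t} (\<lambda>s. h (\<Phi> s x))) {- ?T..?T}"
        using has_integral_shift_Icc_real x int by (metis DiffD1 integrable_integral)
    qed
    also have "\<dots> + (- ?T + t) = I T x"
      using x T by (intro settled_window) auto
    then have "integral {- ?T + t..?T + t} (\<lambda>s. h (\<Phi> s x)) - ?T = I T x - t"
      by linarith
    also have "I T x = \<tau> x" using \<tau>_eq T x by simp
    finally show "\<tau> (\<Phi> t x) = \<tau> x - t" .
  next
    fix c :: real
    define m where "m = \<bar>c\<bar> + 1"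
    obtain W1 where W1: "openin X W1" "A \<subseteq> W1" "\<And>t x. 0 \<le> t \<Longrightarrow> x \<in> W1 \<Longrightarrow> \<Phi> t x \<in> W"
      using stable_nhd[OF W(1,2)] by metis
    \<comment> \<open>Trajectories from \<open>U\<close> see \<open>h = 0\<close> from time \<open>- m\<close> on.\<close>
    define U where "U = W1 \<inter> {x \<in> topspace X. \<forall>s\<in>{-m..0}. \<Phi> s x \<in> W}"
    have "openin X U"
      unfolding U_def using W1 W by (intro openin_Int openin_flow_compact_times) auto
    moreover have "A \<subseteq> U"
      using W1 W A_subset invariant_A by (auto simp: U_def)
    moreover have "\<tau> x < c" if x: "x \<in> U - A" for x
    proof -
      have xX: "x \<in> topspace X" using x by (auto simp: U_def)
      then obtain T where T: "settled T x" "m \<le> T" using ex_settled x by blast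
      have "integral {-T..T} (\<lambda>s. h (\<Phi> s x)) =
            integral {-T..-m} (\<lambda>s. h (\<Phi> s x)) + integral {-m..T} (\<lambda>s. h (\<Phi> s x))"
        using T(2) int[OF xX] by (intro Henstock_Kurzweil_Integration.integral_combine[symmetric]) (auto simp: m_def)
      also have "integral {-m..T} (\<lambda>s. h (\<Phi> s x)) = integral {-m..T} (\<lambda>_. 0)"
      proof (rule integral_cong)
        fix s assume "s \<in> {-m..T}"
        then show "h (\<Phi> s x) = 0"
          using x W1(3) hW by (cases "s \<le> 0") (auto simp: U_def)
      qed
      also have "integral {-T..-m} (\<lambda>s. h (\<Phi> s x)) \<le> integral {-T..-m} (\<lambda>_. 1)"
        using xX h1 int by (intro integral_le) auto
      finally have "integral {-T..T} (\<lambda>s. h (\<Phi> s x)) \<le> T - m"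
        using T(2) by simp
      then have "\<tau> x \<le> - m" using \<tau>_eq[OF T(1) xX] by (simp add: I_def)
      then show ?thesis unfolding m_def by linarith
    qed
    ultimately show "\<exists>U. openin X U \<and> A \<subseteq> U \<and> (\<forall>x\<in>U - A. \<tau> x < c)"
      by blast
  next
    fix c :: real
    obtain s0 where s0: "0 \<le> s0" "\<And>s y. s0 \<le> s \<Longrightarrow> y \<in> N \<Longrightarrow> \<Phi> s y \<in> W"
      using uniform_attraction[OF W(1,2) N] by metis
    \<comment> \<open>A trajectory that avoids \<open>N\<close> during \<open>{0..S}\<close> avoided it at all earlier times as well, since \<open>S\<close> is
        at least the time \<open>s0\<close> after which \<open>N\<close> is absorbed. Then \<open>h = 1\<close> up to time \<open>S\<close>, and \<open>\<tau> x \<ge> S > c\<close>.\<close>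
    define S where "S = max (c + 1) s0"
    define C where "C = (\<lambda>(t, x). \<Phi> t x) ` ({-S..0} \<times> N)"
    have "compactin (prod_topology euclideanreal X) ({-S..0} \<times> N)"
      using N by (simp add: compactin_Times compactin_euclidean_iff)
    then have "compactin X C"
      unfolding C_def using image_compactin flow_continuous by blast
    moreover have "x \<in> C" if x: "x \<in> topspace X - A" and le: "\<tau> x \<le> c" for x
    proof -
      have xX: "x \<in> topspace X" using x by simp
      have "\<exists>s\<in>{0..S}. \<Phi> s x \<in> N"
      proof (rule ccontr)
        assume out: "\<not> (\<exists>s\<in>{0..S}. \<Phi> s x \<in> N)"
        have "\<Phi> s x \<notin> N" if "s \<le> S" for s
        proof (cases "0 \<le> s")
          case True
          then show ?thesis using out that by auto
        next
          case False
          show ?thesis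
          proof
            assume "\<Phi> s x \<in> N"
            then have "\<Phi> (S - s) (\<Phi> s x) \<in> W"
              using False by (intro s0(2)) (auto simp: S_def)
            then have "\<Phi> S x \<in> N" using W(3) xX by (auto simp: flow_add)
            then show False using out s0(1) by (auto simp: S_def)
          qed
        qed
        then have one: "h (\<Phi> s x) = 1" if "s \<le> S" for s
          using that hN xX by simp
        obtain T where T: "settled T x" "S \<le> T" using ex_settled x by blast
        have T0: "0 \<le> T" using T by (simp add: settled_def)
        have "integral {-T..T} (\<lambda>s. h (\<Phi> s x)) =
            integral {-T..S} (\<lambda>s. h (\<Phi> s x)) + integral {S..T} (\<lambda>s. h (\<Phi> s x))"
          using T(2) s0(1) T0 int[OF xX]
          by (intro Henstock_Kurzweil_Integration.integral_combine[symmetric]) (auto simp: S_def)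
        moreover have "integral {-T..S} (\<lambda>s. h (\<Phi> s x)) = integral {-T..S} (\<lambda>_. 1)"
          using one by (intro integral_cong) auto
        moreover have "- T \<le> S" using T0 s0(1) unfolding S_def by linarith
        then have "integral {-T..S} (\<lambda>_. 1::real) = S + T" by simp
        moreover have "0 \<le> integral {S..T} (\<lambda>s. h (\<Phi> s x))"
          using h0 int xX by (intro integral_nonneg) auto
        ultimately have "S + T \<le> integral {-T..T} (\<lambda>s. h (\<Phi> s x))"
          by linarith
        then have "S \<le> \<tau> x" using \<tau>_eq[OF T(1) xX] by (simp add: I_def)
        then show False using le by (simp add: S_def)
      qed
      then obtain s where s: "s \<in> {0..S}" "\<Phi> s x \<in> N" by blast
      then have "x = (case (- s, \<Phi> s x) of (t, x) \<Rightarrow> \<Phi> t x)" using xX by (simp add: flow_add)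
      then show ?thesis unfolding C_def using s by (metis (no_types, lifting) SigmaI atLeastAtMost_iff imageI neg_le_0_iff_le neg_le_iff_le)
    qed
    ultimately show "\<exists>C. compactin X C \<and> (\<forall>x\<in>topspace X - A. \<tau> x \<le> c \<longrightarrow> x \<in> C)" by blast
  qed
qed

end

section \<open>Contracting coordinates\<close>

context attractor
begin

text \<open>
  The point \<open>\<rho> x = \<Phi> (\<tau> x) x\<close> is where the trajectory of \<open>x\<close> meets the cross section \<open>K = {\<tau> = 0}\<close>, and \<open>x\<close> is
  recovered from \<open>\<tau> x\<close> and \<open>\<rho> x\<close>. The coordinates are \<open>exp (\<tau> x) * g (\<rho> x)\<close> for \<open>g\<close> in a separating
  family on \<open>K\<close>; the constant \<open>g = 1\<close> gives \<open>V\<close> and hence \<open>\<tau>\<close>. Boundedness of \<open>g\<close> on the compact set \<open>K\<close>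
  makes them continuous at \<open>A\<close>, where \<open>exp \<tau>\<close> tends to \<open>0\<close>.
\<close>

proposition contracting_coordinates:
  assumes sep: "\<And>K. compactin X K \<Longrightarrow> \<exists>\<G>. finite \<G> \<and> (\<forall>g\<in>\<G>. continuous_map (subtopology X K) euclideanreal g) \<and>
      (\<forall>x\<in>K. \<forall>y\<in>K. (\<forall>g\<in>\<G>. g x = g y) \<longrightarrow> x = y)"
  obtains \<Q> :: "('a \<Rightarrow> real) set" and V
  where "finite \<Q>" "V \<in> \<Q>" "\<forall>q\<in>\<Q>. continuous_map X euclideanreal q"
    "\<forall>q\<in>\<Q>. \<forall>t. \<forall>x\<in>topspace X. q (\<Phi> t x) = exp (- t) * q x"
    "\<forall>x\<in>topspace X. \<forall>y\<in>topspace X. (\<forall>q\<in>\<Q>. q x = q y) \<longrightarrow> x = y \<or> x \<in> A \<and> y \<in> A"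
    "\<forall>c. compactin X {x \<in> topspace X. V x \<le> c}"
proof -
  define D where "D = topspace X - A"
  have A_closed: "closedin X A"
    using compactin_imp_closedin Hausdorff compact_A by blast
  then have D_open: "openin X D" unfolding D_def by blast
  obtain \<tau> where \<tau>: "continuous_map (subtopology X D) euclideanreal \<tau>"
    and \<tau>_flow: "\<And>t x. x \<in> D \<Longrightarrow> \<tau> (\<Phi> t x) = \<tau> x - t"
    and \<tau>_A: "\<And>c. \<exists>U. openin X U \<and> A \<subseteq> U \<and> (\<forall>x\<in>U - A. \<tau> x < c)"
    and \<tau>_compact: "\<And>c. \<exists>C. compactin X C \<and> (\<forall>x\<in>D. \<tau> x \<le> c \<longrightarrow> x \<in> C)"
    using time_to_section unfolding D_def by blast
  have flow_D: "\<Phi> t x \<in> D" if "x \<in> D" for t x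
    using that by (simp add: D_def flow_in_A_iff)
  define K where "K = {x \<in> D. \<tau> x = 0}"
  have K_sub: "K \<subseteq> topspace X" by (auto simp: K_def D_def)
  define \<rho> where "\<rho> x = \<Phi> (\<tau> x) x" for x
  have \<rho>_K: "\<rho> x \<in> K" if "x \<in> D" for x
    using that by (simp add: \<rho>_def K_def flow_D \<tau>_flow)
  have \<rho>: "continuous_map (subtopology X D) (subtopology X K) \<rho>"
    unfolding \<rho>_def using \<rho>_K
    by (auto simp: continuous_map_in_subtopology \<rho>_def continuous_map_from_subtopology
        intro!: flow_continuous_compose \<tau>)
  define q where "q g x = (if x \<in> A then 0 else exp (\<tau> x) * g (\<rho> x))" for g :: "'a \<Rightarrow> real" and x
  define V where "V = q (\<lambda>_. 1)"
  have q_continuous: "continuous_map X euclideanreal (q g)"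
    if g: "continuous_map (subtopology X K) euclideanreal g" and M: "\<And>x. x \<in> K \<Longrightarrow> \<bar>g x\<bar> \<le> M" for g M
  proof (rule continuous_map_eps_nhdI)
    fix x and e :: real assume x: "x \<in> topspace X" and e: "0 < e"
    show "\<exists>U. openin X U \<and> x \<in> U \<and> (\<forall>y\<in>U. dist (q g x) (q g y) < e)"
    proof (cases "x \<in> A")
      case False
      have "continuous_on UNIV (exp :: real \<Rightarrow> real)"
        by (intro continuous_intros)
      then have "continuous_map (subtopology X D) euclideanreal (\<lambda>x. exp (\<tau> x))"
        using continuous_map_compose[OF \<tau>, of euclideanreal exp] by (simp add: o_def)
      moreover have "continuous_map (subtopology X D) euclideanreal (\<lambda>x. g (\<rho> x))"
        using continuous_map_compose[OF \<rho> g] by (simp add: o_def)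
      ultimately have "continuous_map (subtopology X D) euclideanreal (\<lambda>x. exp (\<tau> x) * g (\<rho> x))"
        by (rule continuous_map_real_mult)
      moreover have "x \<in> D" using x False by (simp add: D_def)
      ultimately obtain U where U: "openin (subtopology X D) U" "x \<in> U"
        "\<And>y. y \<in> U \<Longrightarrow> dist (exp (\<tau> x) * g (\<rho> x)) (exp (\<tau> y) * g (\<rho> y)) < e"
        using continuous_map_eps_nhdD[of _ _ x e] e D_open openin_subset by (metis (no_types, lifting) topspace_subtopology_subset)
      then have "openin X U" "U \<subseteq> D"
        using D_open by (simp_all add: openin_open_subtopology)
      then show ?thesis using U(2,3) False by (intro exI[of _ U]) (auto simp: q_def D_def)
    next
      case True
      define r where "r = e / (\<bar>M\<bar> + 1)"
      have r: "0 < r" using e by (simp add: r_def add_nonneg_pos)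
      obtain U where U: "openin X U" "A \<subseteq> U" "\<forall>y\<in>U - A. \<tau> y < ln r"
        using \<tau>_A by blast
      have "dist (q g x) (q g y) < e" if y: "y \<in> U" for y
      proof (cases "y \<in> A")
        case True
        then show ?thesis using \<open>x \<in> A\<close> e by (simp add: q_def)
      next
        case False
        then have "y \<in> D" using y U(1) openin_subset by (fastforce simp: D_def)
        then have gM: "\<bar>g (\<rho> y)\<bar> \<le> \<bar>M\<bar>" using M[OF \<rho>_K] by fastforce
        have "exp (\<tau> y) < r" using U(3) y False r by (metis DiffI exp_less_mono exp_ln)
        then have "exp (\<tau> y) * \<bar>g (\<rho> y)\<bar> \<le> r * \<bar>M\<bar>"
          using gM r by (intro mult_mono) auto
        also have "\<dots> < r * (\<bar>M\<bar> + 1)" using r by (simp add: mult_strict_left_mono)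
        also have "\<dots> = e" using abs_ge_zero[of M] by (simp add: r_def)
        finally show ?thesis using \<open>x \<in> A\<close> False by (simp add: q_def dist_real_def abs_mult)
      qed
      then show ?thesis using U True by blast
    qed
  qed
  have V_continuous: "continuous_map X euclideanreal V"
    unfolding V_def by (rule q_continuous[of _ 1]) auto
  have V_A: "V x = 0 \<longleftrightarrow> x \<in> A" for x by (simp add: V_def q_def)
  have V_D: "V x = exp (\<tau> x)" if "x \<in> D" for x using that by (simp add: V_def q_def D_def)
  have sublevel: "compactin X {x \<in> topspace X. V x \<le> c}" for c
  proof -
    obtain C where C: "compactin X C" "\<forall>x\<in>D. \<tau> x \<le> ln (max c 1) \<longrightarrow> x \<in> C"
      using \<tau>_compact by blast
    have "{x \<in> topspace X. V x \<le> c} \<subseteq> A \<union> C"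
    proof
      fix x assume x: "x \<in> {x \<in> topspace X. V x \<le> c}"
      show "x \<in> A \<union> C"
      proof (cases "x \<in> A")
        case False
        then have "x \<in> D" using x by (simp add: D_def)
        then have "exp (\<tau> x) \<le> max c 1" using x V_D by fastforce
        then have "\<tau> x \<le> ln (max c 1)" by (simp add: ln_ge_iff)
        then show ?thesis using C(2) \<open>x \<in> D\<close> by blast
      qed blast
    qed
    then show ?thesis
      using closed_compactin[OF _ _ closedin_real_le(1)[OF V_continuous]] compact_A C(1) compactin_Un by metis
  qed
  \<comment> \<open>Only now, with \<open>V\<close> continuous on the whole space and its sublevel sets compact, is \<open>K\<close> seen to be compact.\<close>
  have "K = {x \<in> topspace X. V x = 1}"
    using V_D by (auto simp: K_def D_def V_def q_def)
  then have K_closed: "closedin X K" using closedin_real_le(2)[OF V_continuous] by simp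
  have "K \<subseteq> {x \<in> topspace X. V x \<le> 1}" using V_D K_sub by (auto simp: K_def)
  then have K_compact: "compactin X K" using closed_compactin[OF sublevel _ K_closed] by blast
  then obtain \<G> where \<G>: "finite \<G>" "\<And>g. g \<in> \<G> \<Longrightarrow> continuous_map (subtopology X K) euclideanreal g"
      "\<And>x y. \<lbrakk>x \<in> K; y \<in> K; \<forall>g\<in>\<G>. g x = g y\<rbrakk> \<Longrightarrow> x = y"
    using sep[OF K_compact] by metis
  define \<Q> where "\<Q> = q ` insert (\<lambda>_. 1) \<G>"
  show ?thesis
  proof
    show "finite \<Q>" "V \<in> \<Q>" using \<G>(1) by (simp_all add: \<Q>_def V_def)
    show "\<forall>q\<in>\<Q>. continuous_map X euclideanreal q"
    proof
      fix f assume "f \<in> \<Q>"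
      then obtain g where g: "f = q g" "continuous_map (subtopology X K) euclideanreal g"
        using \<G>(2) by (auto simp: \<Q>_def)
      have "compactin (subtopology X K) K" using K_compact by (simp add: compactin_subtopology)
      then have "compact (g ` K)"
        using image_compactin[OF _ g(2)] by (simp add: compactin_euclidean_iff)
      then obtain M where "\<And>x. x \<in> K \<Longrightarrow> \<bar>g x\<bar> \<le> M"
        using compact_imp_bounded bounded_real by (metis imageI)
      then show "continuous_map X euclideanreal f" using g q_continuous by metis
    qed
    show "\<forall>q\<in>\<Q>. \<forall>t. \<forall>x\<in>topspace X. q (\<Phi> t x) = exp (- t) * q x"
    proof (clarsimp simp: \<Q>_def, rule conjI; clarify)
      have *: "q g (\<Phi> t x) = exp (- t) * q g x" if "x \<in> topspace X" for g t x
      proof (cases "x \<in> A")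
        case False
        then have D: "x \<in> D" using that by (simp add: D_def)
        then have "\<rho> (\<Phi> t x) = \<rho> x" using that by (simp add: \<rho>_def \<tau>_flow flow_add)
        then show ?thesis using False that D by (simp add: q_def flow_in_A_iff \<tau>_flow exp_diff exp_minus field_simps)
      qed (simp add: q_def invariant_A)
      then show "q (\<lambda>_. 1) (\<Phi> t x) = exp (- t) * q (\<lambda>_. 1) x" if "x \<in> topspace X" for t x
        using that by blast
      show "q g (\<Phi> t x) = exp (- t) * q g x" if "x \<in> topspace X" "g \<in> \<G>" for g t x
        using * that by blast
    qed
    show "\<forall>x\<in>topspace X. \<forall>y\<in>topspace X. (\<forall>q\<in>\<Q>. q x = q y) \<longrightarrow> x = y \<or> x \<in> A \<and> y \<in> A"
    proof (intro ballI impI)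
      fix x y assume x: "x \<in> topspace X" and y: "y \<in> topspace X" and eq: "\<forall>q\<in>\<Q>. q x = q y"
      then have Veq: "V x = V y" by (simp add: \<Q>_def V_def)
      show "x = y \<or> x \<in> A \<and> y \<in> A"
      proof (cases "x \<in> A")
        case True
        then show ?thesis using Veq V_A by metis
      next
        case False
        then have "y \<notin> A" using Veq V_A by metis
        then have D: "x \<in> D" "y \<in> D" using x y False by (auto simp: D_def)
        then have \<tau>eq: "\<tau> x = \<tau> y" using Veq V_D by simp
        have "g (\<rho> x) = g (\<rho> y)" if "g \<in> \<G>" for g
        proof -
          have "q g x = q g y" using eq that by (simp add: \<Q>_def)
          then show ?thesis using False \<open>y \<notin> A\<close> \<tau>eq by (simp add: q_def)
        qed
        then have "\<rho> x = \<rho> y" using \<G>(3) \<rho>_K D by blast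
        then have "\<Phi> (- \<tau> x) (\<rho> x) = \<Phi> (- \<tau> y) (\<rho> y)" using \<tau>eq by simp
        then show ?thesis using x y by (simp add: \<rho>_def flow_add)
      qed
    qed
    show "\<forall>c. compactin X {x \<in> topspace X. V x \<le> c}" using sublevel by blast
  qed
qed

end

section \<open>Finitely many functions separating a compact subset of a manifold\<close>

text \<open>
  A chart multiplied by a bump function \<open>\<mu>\<close> extends to the whole space. If \<open>\<mu> x > 0\<close>, then agreement of \<open>\<mu>\<close> at
  \<open>x\<close> and \<open>y\<close> puts \<open>y\<close> into the chart domain, and agreement of the products gives agreement of the chart
  coordinates. Finitely many of the sets \<open>{\<mu> > 0}\<close> cover the space.
\<close>

lemma compact_space_separating_functions:
  assumes Z: "compact_space Z" "Hausdorff_space Z"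
    and charts: "\<And>p. p \<in> topspace Z \<Longrightarrow> \<exists>U (n::nat) \<phi>. openin Z U \<and> p \<in> U \<and>
        (\<forall>i<n. continuous_map (subtopology Z U) euclideanreal (\<lambda>x. \<phi> x i)) \<and>
        (\<forall>x\<in>U. \<forall>y\<in>U. (\<forall>i<n. \<phi> x i = \<phi> y i) \<longrightarrow> x = y)"
  obtains \<G> where "finite \<G>" "\<forall>g\<in>\<G>. continuous_map Z euclideanreal g"
      "\<forall>x\<in>topspace Z. \<forall>y\<in>topspace Z. (\<forall>g\<in>\<G>. g x = g y) \<longrightarrow> x = y"
proof -
  have "completely_regular_space Z"
    using Z compact_imp_locally_compact_space locally_compact_regular_imp_completely_regular_space by blast
  have local: "\<exists>W \<G>. openin Z W \<and> p \<in> W \<and> finite \<G> \<and> (\<forall>g\<in>\<G>. continuous_map Z euclideanreal g) \<and>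
      (\<forall>x\<in>W. \<forall>y\<in>topspace Z. (\<forall>g\<in>\<G>. g x = g y) \<longrightarrow> x = y)" if p: "p \<in> topspace Z" for p
  proof -
    obtain U and n :: nat and \<phi> where U: "openin Z U" "p \<in> U"
      and \<phi>: "\<And>i. i < n \<Longrightarrow> continuous_map (subtopology Z U) euclideanreal (\<lambda>x. \<phi> x i)"
      and inj: "\<And>x y. \<lbrakk>x \<in> U; y \<in> U; \<forall>i<n. \<phi> x i = \<phi> y i\<rbrakk> \<Longrightarrow> x = y"
      using charts[OF p] by metis
    have "closedin Z (topspace Z - U)" "p \<in> topspace Z - (topspace Z - U)"
      using U p by auto
    then obtain f :: "'a \<Rightarrow> real" where f: "continuous_map Z (top_of_set {0..1}) f" "f p = 0" "f ` (topspace Z - U) \<subseteq> {1}"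
      using \<open>completely_regular_space Z\<close> unfolding completely_regular_space_def by metis
    have cf: "continuous_map Z euclideanreal f"
      using f(1) by (simp add: continuous_map_in_subtopology)
    \<comment> \<open>Clamping at \<open>1/2\<close> makes \<open>\<mu>\<close> vanish on the open set \<open>V\<close> below, which together with \<open>U\<close> covers the space.\<close>
    define \<mu> where "\<mu> x = max 0 (1/2 - f x)" for x
    have c\<mu>: "continuous_map Z euclideanreal \<mu>"
      unfolding \<mu>_def by (intro continuous_intros cf)
    define g where "g i x = (if x \<in> U then \<mu> x * \<phi> x i else 0)" for i x
    define V where "V = {x \<in> topspace Z. 1/2 < f x}"
    have V: "openin Z V"
      unfolding V_def using openin_continuous_map_preimage[OF cf, of "{1/2<..}"] by simp
    have cg: "continuous_map Z euclideanreal (g i)" if i: "i < n" for i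
    proof (rule pasting_lemma[where I = "{True, False}" and T = "\<lambda>b. if b then U else V"
            and f = "\<lambda>b. if b then \<lambda>x. \<mu> x * \<phi> x i else (\<lambda>_. 0)"])
      fix b :: bool
      show "openin Z (if b then U else V)" using U V by simp
      have "continuous_map (subtopology Z U) euclideanreal (\<lambda>x. \<mu> x * \<phi> x i)"
        by (rule continuous_map_real_mult[OF continuous_map_from_subtopology[OF c\<mu>] \<phi>[OF i]])
      then show "continuous_map (subtopology Z (if b then U else V)) euclideanreal
            (if b then \<lambda>x. \<mu> x * \<phi> x i else (\<lambda>_. 0))" by simp
    next
      fix b c :: bool and x
      assume "x \<in> topspace Z \<inter> (if b then U else V) \<inter> (if c then U else V)"
      then show "(if b then \<lambda>x. \<mu> x * \<phi> x i else (\<lambda>_. 0)) x = (if c then \<lambda>x. \<mu> x * \<phi> x i else (\<lambda>_. 0)) x"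
        by (auto simp: V_def \<mu>_def split: if_splits)
    next
      fix x assume x: "x \<in> topspace Z"
      show "\<exists>b. b \<in> {True, False} \<and> x \<in> (if b then U else V) \<and> g i x = (if b then \<lambda>x. \<mu> x * \<phi> x i else (\<lambda>_. 0)) x"
      proof (cases "x \<in> U")
        case False
        then have "f x = 1" using f(3) x by blast
        then show ?thesis using x False by (intro exI[of _ False]) (simp add: V_def g_def)
      qed (auto simp: g_def)
    qed
    let ?W = "{x \<in> topspace Z. f x < 1/2}"
    let ?\<G> = "insert \<mu> (g ` {..<n})"
    have "openin Z ?W"
      using openin_continuous_map_preimage[OF cf, of "{..<1/2}"] by simp
    moreover have "x = y" if x: "x \<in> ?W" and y: "y \<in> topspace Z" and eq: "\<forall>h\<in>?\<G>. h x = h y" for x y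
    proof -
      have "\<mu> x > 0" using x by (simp add: \<mu>_def)
      then have "\<mu> y > 0" and \<mu>eq: "\<mu> x = \<mu> y" using eq by auto
      then have "f x \<noteq> 1" "f y \<noteq> 1" using x by (auto simp: \<mu>_def)
      then have xyU: "x \<in> U" "y \<in> U" using f(3) x y by auto
      have "\<phi> x i = \<phi> y i" if "i < n" for i
      proof -
        have "g i x = g i y" using eq that by auto
        then show ?thesis using xyU \<mu>eq \<open>\<mu> y > 0\<close> by (simp add: g_def)
      qed
      then show ?thesis using inj xyU by blast
    qed
    moreover have "\<forall>h\<in>?\<G>. continuous_map Z euclideanreal h" using c\<mu> cg by auto
    moreover have "p \<in> ?W" using p f(2) by simp
    ultimately show ?thesis by (intro exI[of _ ?W] exI[of _ ?\<G>]) blast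
  qed
  then obtain W \<G> where W: "\<And>p. p \<in> topspace Z \<Longrightarrow> openin Z (W p) \<and> p \<in> W p"
    and \<G>: "\<And>p. p \<in> topspace Z \<Longrightarrow> finite (\<G> p) \<and> (\<forall>g\<in>\<G> p. continuous_map Z euclideanreal g)"
    and sep: "\<And>p x y. \<lbrakk>p \<in> topspace Z; x \<in> W p; y \<in> topspace Z; \<forall>g\<in>\<G> p. g x = g y\<rbrakk> \<Longrightarrow> x = y"
    by metis
  have "topspace Z \<subseteq> \<Union> (W ` topspace Z)" "\<And>U. U \<in> W ` topspace Z \<Longrightarrow> openin Z U"
    using W by auto
  then obtain \<F> where "finite \<F>" "\<F> \<subseteq> W ` topspace Z" "topspace Z \<subseteq> \<Union>\<F>"
    using Z(1) unfolding compact_space_alt by metis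
  then obtain P where P: "finite P" "P \<subseteq> topspace Z" "topspace Z \<subseteq> \<Union> (W ` P)"
    by (metis finite_subset_image)
  show ?thesis
  proof
    show "finite (\<Union> (\<G> ` P))" "\<forall>g\<in>\<Union> (\<G> ` P). continuous_map Z euclideanreal g"
      using P \<G> by auto
    show "\<forall>x\<in>topspace Z. \<forall>y\<in>topspace Z. (\<forall>g\<in>\<Union> (\<G> ` P). g x = g y) \<longrightarrow> x = y"
    proof (intro ballI impI)
      fix x y assume xy: "x \<in> topspace Z" "y \<in> topspace Z" "\<forall>g\<in>\<Union> (\<G> ` P). g x = g y"
      then obtain p where "p \<in> P" "x \<in> W p" using P(3) by auto
      then show "x = y" using sep[of p x y] xy P(2) by auto
    qed
  qed
qed

text \<open>
  The charts of the manifold, pulled back to \<open>K\<close>, are the local separating functions required above.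
\<close>

lemma manifold_subspace_compact_separating_functions:
  assumes M: "manifold M" and hom: "X homeomorphic_space subtopology M S" and K: "compactin X K"
  shows "\<exists>\<G>. finite \<G> \<and> (\<forall>g\<in>\<G>. continuous_map (subtopology X K) euclideanreal g) \<and>
      (\<forall>x\<in>K. \<forall>y\<in>K. (\<forall>g\<in>\<G>. g x = g y) \<longrightarrow> x = y)"
proof -
  let ?Z = "subtopology X K"
  have K_sub: "K \<subseteq> topspace X" using K by (simp add: compactin_subset_topspace)
  then have topZ: "topspace ?Z = K" by auto
  obtain h k where hk: "homeomorphic_maps X (subtopology M S) h k"
    using hom unfolding homeomorphic_space_def by blast
  then have h: "continuous_map X M h" and h_inj: "\<And>x y. \<lbrakk>x \<in> topspace X; y \<in> topspace X; h x = h y\<rbrakk> \<Longrightarrow> x = y"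
    unfolding homeomorphic_maps_def by (auto simp: continuous_map_in_subtopology) metis
  have hZ: "continuous_map ?Z M h" using h by (rule continuous_map_from_subtopology)
  have "Hausdorff_space X"
    using M hom homeomorphic_Hausdorff_space Hausdorff_space_subtopology unfolding manifold_def by metis
  then have HZ: "Hausdorff_space ?Z" by (rule Hausdorff_space_subtopology)
  have CZ: "compact_space ?Z" using K by (simp add: compact_space_subtopology)
  have charts: "\<exists>U (n::nat) \<phi>. openin ?Z U \<and> p \<in> U \<and>
        (\<forall>i<n. continuous_map (subtopology ?Z U) euclideanreal (\<lambda>x. \<phi> x i)) \<and>
        (\<forall>x\<in>U. \<forall>y\<in>U. (\<forall>i<n. \<phi> x i = \<phi> y i) \<longrightarrow> x = y)" if p: "p \<in> topspace ?Z" for p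
  proof -
    have "h p \<in> topspace M" using continuous_map_funspace[OF hZ] p by blast
    then obtain n U V where U: "openin M U" "h p \<in> U"
      and "subtopology M U homeomorphic_space subtopology (Euclidean_space n) V"
      using M unfolding manifold_def by metis
    then obtain \<phi> \<psi> where "homeomorphic_maps (subtopology M U) (subtopology (Euclidean_space n) V) \<phi> \<psi>"
      unfolding homeomorphic_space_def by blast
    then have \<phi>: "continuous_map (subtopology M U) (Euclidean_space n) \<phi>"
      and \<phi>_inj: "\<And>x y. \<lbrakk>x \<in> U; y \<in> U; \<phi> x = \<phi> y\<rbrakk> \<Longrightarrow> x = y"
      using openin_subset[OF U(1)]
      unfolding homeomorphic_maps_def by (auto simp: continuous_map_in_subtopology Int_absorb1) metis
    let ?U = "{x \<in> topspace ?Z. h x \<in> U}"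
    have U_open: "openin ?Z ?U" by (rule openin_continuous_map_preimage[OF hZ U(1)])
    have "continuous_map (subtopology ?Z ?U) (subtopology M U) h"
      by (auto simp: continuous_map_in_subtopology intro: continuous_map_from_subtopology[OF hZ])
    from continuous_map_compose[OF this \<phi>]
    have c: "continuous_map (subtopology ?Z ?U) (Euclidean_space n) (\<lambda>x. \<phi> (h x))"
      by (simp add: o_def)
    then have "continuous_map (subtopology ?Z ?U) euclideanreal (\<lambda>x. \<phi> (h x) i)" for i
      unfolding Euclidean_space_def continuous_map_in_subtopology continuous_map_componentwise_UNIV by blast
    moreover have "x = y" if x: "x \<in> ?U" and y: "y \<in> ?U" and eq: "\<forall>i<n. \<phi> (h x) i = \<phi> (h y) i" for x y
    proof -
      have "\<phi> (h z) \<in> topspace (Euclidean_space n)" if "z \<in> ?U" for z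
        using funcset_mem[OF continuous_map_funspace[OF c]] that openin_subset[OF U_open] by auto
      then have "\<phi> (h x) i = \<phi> (h y) i" for i
        using eq x y by (cases "i < n") (auto simp: topspace_Euclidean_space)
      then have "\<phi> (h x) = \<phi> (h y)" by blast
      then have "h x = h y" using \<phi>_inj x y by blast
      then show ?thesis using h_inj x y K_sub by auto
    qed
    moreover have "p \<in> ?U" using p U(2) by simp
    ultimately show ?thesis
      using U_open by (intro exI[of _ ?U] exI[of _ n] exI[of _ "\<lambda>x. \<phi> (h x)"] conjI ballI) blast+
  qed
  obtain \<G> where "finite \<G>" "\<forall>g\<in>\<G>. continuous_map ?Z euclideanreal g"
      "\<forall>x\<in>topspace ?Z. \<forall>y\<in>topspace ?Z. (\<forall>g\<in>\<G>. g x = g y) \<longrightarrow> x = y"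
    by (rule compact_space_separating_functions[OF CZ HZ charts])
  then show ?thesis unfolding topZ by blast
qed

section \<open>Periodic orbits\<close>

text \<open>
  A closed subgroup of the reals with a positive element is either dense, hence everything (take \<open>\<omega> = 0\<close>), or
  consists of the multiples of its least positive element \<open>s\<close> (take \<open>\<omega> = 2 * pi / s\<close>). For the periods
  of an orbit, the first case means that the orbit is constant.
\<close>

lemma closed_real_subgroup_eq_cis_kernel:
  fixes P :: "real set"
  assumes closed: "closed P" and diff: "\<And>s t. \<lbrakk>s \<in> P; t \<in> P\<rbrakk> \<Longrightarrow> s - t \<in> P"
    and T: "T \<in> P" "0 < T"
  obtains \<omega> where "\<And>t. t \<in> P \<longleftrightarrow> cis (\<omega> * t) = 1"
proof -
  have zero: "0 \<in> P" using diff[OF T(1) T(1)] by simp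
  have neg: "- t \<in> P" if "t \<in> P" for t using diff[OF zero that] by simp
  have add: "s + t \<in> P" if "s \<in> P" "t \<in> P" for s t using diff[OF that(1) neg[OF that(2)]] by simp
  have nat_mult: "of_nat n * t \<in> P" if "t \<in> P" for n t
    by (induction n) (auto simp: zero add that distrib_right)
  have int_mult: "of_int n * t \<in> P" if "t \<in> P" for n t
  proof (cases "0 \<le> n")
    case True
    then show ?thesis using nat_mult[OF that, of "nat n"] by simp
  next
    case False
    then show ?thesis using neg[OF nat_mult[OF that, of "nat (- n)"]] by simp
  qed
  have remainder: "t - of_int \<lfloor>t / s\<rfloor> * s \<in> P \<longleftrightarrow> t \<in> P"
    and bounds: "0 \<le> t - of_int \<lfloor>t / s\<rfloor> * s" "t - of_int \<lfloor>t / s\<rfloor> * s < s" if "s \<in> P" "0 < s" for s t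
  proof -
    show "t - of_int \<lfloor>t / s\<rfloor> * s \<in> P \<longleftrightarrow> t \<in> P"
      using diff int_mult[OF that(1)] add by (metis diff_add_cancel)
    show "0 \<le> t - of_int \<lfloor>t / s\<rfloor> * s" "t - of_int \<lfloor>t / s\<rfloor> * s < s"
      using floor_divide_lower[OF that(2), of t] floor_divide_upper[OF that(2), of t]
      by (simp_all add: distrib_right)
  qed
  show ?thesis
  proof (cases "\<forall>e>0. \<exists>s\<in>P. 0 < s \<and> s < e")
    case True
    have "t \<in> P" for t
    proof -
      have "\<exists>y\<in>P. dist y t < e" if e: "0 < e" for e
      proof -
        obtain s where s: "s \<in> P" "0 < s" "s < e" using True e by blast
        then have "dist (of_int \<lfloor>t / s\<rfloor> * s) t < e"
          using bounds[OF s(1,2), of t] by (simp add: dist_real_def)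
        then show ?thesis using int_mult[OF s(1)] by blast
      qed
      then show ?thesis using closed closure_approachable[of t P] by simp
    qed
    then show ?thesis using that[of 0] by simp
  next
    case False
    then obtain e where e: "0 < e" "\<And>s. \<lbrakk>s \<in> P; 0 < s\<rbrakk> \<Longrightarrow> e \<le> s" by (meson not_le)
    define Q where "Q = P \<inter> {e..}"
    have Q: "closed Q" "Q \<noteq> {}" "bdd_below Q"
      using closed T e by (auto simp: Q_def intro: closed_Int)
    define s where "s = Inf Q"
    have "s \<in> Q" unfolding s_def using closed_contains_Inf Q by blast
    then have s: "s \<in> P" "0 < s" using e(1) by (auto simp: Q_def)
    have s_least: "s \<le> r" if "r \<in> P" "0 < r" for r
      unfolding s_def using that e Q by (intro cInf_lower) (auto simp: Q_def)
    have "t \<in> P \<longleftrightarrow> cis (2 * pi / s * t) = 1" for t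
    proof
      assume "t \<in> P"
      then have "\<not> 0 < t - of_int \<lfloor>t / s\<rfloor> * s"
        using remainder[OF s] bounds(2)[OF s, of t] s_least by (meson not_le)
      then have "t = of_int \<lfloor>t / s\<rfloor> * s" using bounds(1)[OF s, of t] by linarith
      then have "2 * pi / s * t = 2 * pi * of_int \<lfloor>t / s\<rfloor>"
        using s(2) by (metis nonzero_mult_div_cancel_right less_irrefl mult.assoc mult.commute times_divide_eq_left)
      then show "cis (2 * pi / s * t) = 1" by (simp add: cis_multiple_2pi)
    next
      assume "cis (2 * pi / s * t) = 1"
      then have "cos (2 * pi / s * t) = 1" by (metis cis.simps(1) one_complex.simps(1))
      then obtain n where "2 * pi / s * t = of_int n * 2 * pi" using cos_one_2pi_int by blast
      then have "t = of_int n * s" using s(2) by (simp add: field_simps)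
      then show "t \<in> P" using int_mult[OF s(1)] by simp
    qed
    then show ?thesis using that by blast
  qed
qed

context continuous_flow
begin

lemma orbit_continuous:
  assumes "x \<in> topspace X"
  shows "continuous_map euclideanreal X (\<lambda>t. \<Phi> t x)"
  using flow_continuous_compose[of euclideanreal id "\<lambda>_. x"] assms by simp

lemma periodic_multiple:
  assumes x0: "x0 \<in> topspace X" and per: "\<And>t. \<Phi> (t + T) x0 = \<Phi> t x0"
  shows "\<Phi> (of_nat k * T) x0 = x0"
proof (induction k)
  case (Suc k)
  then show ?case using per[of "of_nat k * T"] by (simp add: distrib_right add.commute)
qed (simp add: x0)

lemma periodic_orbit_compact_interval:
  assumes x0: "x0 \<in> topspace X" and T: "0 < T" and per: "\<And>t. \<Phi> (t + T) x0 = \<Phi> t x0"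
  shows "range (\<lambda>t. \<Phi> t x0) = (\<lambda>t. \<Phi> t x0) ` {0..T}"
proof -
  have "\<Phi> t x0 \<in> (\<lambda>t. \<Phi> t x0) ` {0..T}" for t
  proof -
    define r where "r = t - of_int \<lfloor>t / T\<rfloor> * T"
    have r: "r \<in> {0..T}"
      using floor_divide_lower[OF T, of t] floor_divide_upper[OF T, of t]
      by (simp add: r_def distrib_right)
    have "\<Phi> (of_int n * T) x0 = x0" for n
    proof (cases "0 \<le> n")
      case True
      then show ?thesis using periodic_multiple[OF x0 per, of "nat n"] by simp
    next
      case False
      have "\<Phi> (of_int n * T) (\<Phi> (of_nat (nat (- n)) * T) x0) = x0"
        using False x0 by (simp add: flow_add)
      then show ?thesis using periodic_multiple[OF x0 per] by simp
    qed
    then have "\<Phi> r (\<Phi> (of_int \<lfloor>t / T\<rfloor> * T) x0) = \<Phi> r x0" by simp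
    then have "\<Phi> t x0 = \<Phi> r x0" using x0 by (simp add: flow_add r_def)
    then show ?thesis using r by blast
  qed
  then show ?thesis by blast
qed

lemma periodic_orbit_compact:
  assumes "x0 \<in> topspace X" "0 < T" "\<And>t. \<Phi> (t + T) x0 = \<Phi> t x0"
  shows "compactin X (range (\<lambda>t. \<Phi> t x0))"
  unfolding periodic_orbit_compact_interval[OF assms]
  using image_compactin[OF _ orbit_continuous[OF assms(1)]] by (simp add: compactin_euclidean_iff)

text \<open>
  The periods of \<open>x0\<close> form a closed subgroup of the reals, the kernel of \<open>t \<mapsto> cis (\<omega> * t)\<close> for some \<open>\<omega>\<close>. Hence
  \<open>\<Phi> t x0 \<mapsto> cis (\<omega> * t)\<close> is well defined and injective. It is continuous because preimages of closed sets are
  images of compact sets of times.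
\<close>

proposition periodic_orbit_circle_coordinate:
  assumes Hausdorff: "Hausdorff_space X"
    and x0: "x0 \<in> topspace X" and T: "0 < T" and per: "\<And>t. \<Phi> (t + T) x0 = \<Phi> t x0"
    and A: "A = range (\<lambda>t. \<Phi> t x0)"
  obtains \<omega> and \<theta> :: "'a \<Rightarrow> complex"
  where "continuous_map (subtopology X A) euclidean \<theta>" "inj_on \<theta> A"
    "\<forall>t. \<forall>a\<in>A. \<theta> (\<Phi> t a) = cis (\<omega> * t) * \<theta> a"
proof -
  define P where "P = {t. \<Phi> t x0 = x0}"
  have A_sub: "A \<subseteq> topspace X" using A x0 by auto
  have "closedin euclideanreal {t \<in> topspace euclideanreal. \<Phi> t x0 \<in> {x0}}"
    using orbit_continuous[OF x0] Hausdorff x0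
    by (intro closedin_continuous_map_preimage) (auto simp: closedin_Hausdorff_singleton)
  then have "closed P" by (simp add: P_def)
  moreover have "s - t \<in> P" if "s \<in> P" "t \<in> P" for s t
  proof -
    have "\<Phi> (s - t) (\<Phi> t x0) = \<Phi> s x0" using x0 by (simp add: flow_add)
    then show ?thesis using that by (simp add: P_def)
  qed
  moreover have "T \<in> P" using per[of 0] x0 by (simp add: P_def)
  ultimately obtain \<omega> where \<omega>: "\<And>t. t \<in> P \<longleftrightarrow> cis (\<omega> * t) = 1"
    using closed_real_subgroup_eq_cis_kernel[of P T] T by metis
  have eq_iff: "\<Phi> s x0 = \<Phi> t x0 \<longleftrightarrow> cis (\<omega> * s) = cis (\<omega> * t)" for s t
  proof -
    have "\<Phi> s x0 = \<Phi> t x0 \<longleftrightarrow> \<Phi> (- t) (\<Phi> s x0) = \<Phi> (- t) (\<Phi> t x0)"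
      using x0 by (metis add.right_inverse flow_0 flow_add flow_in)
    also have "\<dots> \<longleftrightarrow> s - t \<in> P" using x0 by (simp add: flow_add P_def)
    also have "\<dots> \<longleftrightarrow> cis (\<omega> * s) = cis (\<omega> * t)"
      using \<omega> by (simp add: right_diff_distrib flip: cis_divide)
    finally show ?thesis .
  qed
  define \<theta> where "\<theta> a = cis (\<omega> * (SOME t. \<Phi> t x0 = a))" for a
  have \<theta>: "\<theta> (\<Phi> t x0) = cis (\<omega> * t)" for t
    unfolding \<theta>_def using someI[of "\<lambda>s. \<Phi> s x0 = \<Phi> t x0" t] eq_iff by blast
  show ?thesis
  proof
    show "inj_on \<theta> A" by (auto simp: inj_on_def A \<theta> eq_iff)
    show "\<forall>t. \<forall>a\<in>A. \<theta> (\<Phi> t a) = cis (\<omega> * t) * \<theta> a"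
      using x0 by (auto simp: A flow_add \<theta> distrib_left cis_mult)
    show "continuous_map (subtopology X A) euclidean \<theta>"
      unfolding continuous_map_closedin
    proof (intro conjI allI impI ballI)
      fix C :: "complex set" assume "closedin euclidean C"
      let ?I = "{0..T} \<inter> {t. cis (\<omega> * t) \<in> C}"
      have "closed {t. cis (\<omega> * t) \<in> C}"
        using \<open>closedin euclidean C\<close> continuous_closed_vimage[of C "\<lambda>t. cis (\<omega> * t)"]
        by (simp add: vimage_def cis_conv_exp)
      then have "compact ?I" by (intro compact_Int_closed) auto
      then have "compactin X ((\<lambda>t. \<Phi> t x0) ` ?I)"
        using image_compactin[OF _ orbit_continuous[OF x0]] by (simp add: compactin_euclidean_iff)
      then have "closedin X ((\<lambda>t. \<Phi> t x0) ` ?I)"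
        using Hausdorff compactin_imp_closedin by blast
      moreover have "(\<lambda>t. \<Phi> t x0) ` ?I = {x \<in> topspace (subtopology X A). \<theta> x \<in> C}"
        using periodic_orbit_compact_interval[OF x0 T per] x0 by (auto simp: A \<theta>)
      ultimately show "closedin (subtopology X A) {x \<in> topspace (subtopology X A). \<theta> x \<in> C}"
        by (metis (no_types, lifting) closedin_subset_topspace inf.cobounded2 mem_Collect_eq subsetI topspace_subtopology IntD2)
    qed auto
  qed
qed

end

section \<open>Asymptotic phase from linear coordinates\<close>

text \<open>
  The vectors \<open>f x\<close>, \<open>x \<in> S\<close>, truncated to \<open>n\<close> coordinates, are combinations of finitely many among them, with
  coefficients that depend on the truncated vector in a Lipschitz way. The induction on \<open>n\<close> is Gaussian
  elimination: \<open>r x\<close> is the error in the new coordinate of the combination found so far, and if some \<open>w\<close> has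
  nonzero error, then adding \<open>w\<close> with coefficient \<open>r x / r w\<close> and correcting the old coefficients removes it.
\<close>

lemma finite_spanning_coordinates:
  fixes f :: "'a \<Rightarrow> nat \<Rightarrow> real"
  shows "\<exists>(m::nat) p a C. 0 \<le> C \<and> (\<forall>i<m. p i \<in> S) \<and>
    (\<forall>x\<in>S. \<forall>j<n. f x j = (\<Sum>i<m. a i x * f (p i) j)) \<and>
    (\<forall>i<m. \<forall>x\<in>S. \<forall>y\<in>S. \<bar>a i x - a i y\<bar> \<le> C * (\<Sum>l<n. \<bar>f x l - f y l\<bar>))"
proof (induction n)
  case 0
  show ?case by (intro exI[of _ 0]) auto
next
  case (Suc n)
  then obtain m :: nat and p a C where IH: "0 \<le> C \<and> (\<forall>i<m. p i \<in> S) \<and>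
      (\<forall>x\<in>S. \<forall>j<n. f x j = (\<Sum>i<m. a i x * f (p i) j)) \<and>
      (\<forall>i<m. \<forall>x\<in>S. \<forall>y\<in>S. \<bar>a i x - a i y\<bar> \<le> C * (\<Sum>l<n. \<bar>f x l - f y l\<bar>))"
    by (elim exE) (rule that)
  have C: "0 \<le> C" and p: "\<And>i. i < m \<Longrightarrow> p i \<in> S"
    and a: "\<And>x j. \<lbrakk>x \<in> S; j < n\<rbrakk> \<Longrightarrow> f x j = (\<Sum>i<m. a i x * f (p i) j)"
    and lip: "\<And>i x y. \<lbrakk>i < m; x \<in> S; y \<in> S\<rbrakk> \<Longrightarrow> \<bar>a i x - a i y\<bar> \<le> C * (\<Sum>l<n. \<bar>f x l - f y l\<bar>)"
    using IH by blast+
  define d where "d x y = (\<Sum>l<Suc n. \<bar>f x l - f y l\<bar>)" for x y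
  have d0: "0 \<le> d x y" for x y by (simp add: d_def sum_nonneg)
  have lip': "\<bar>a i x - a i y\<bar> \<le> C * d x y" if "i < m" "x \<in> S" "y \<in> S" for i x y
  proof -
    have "C * (\<Sum>l<n. \<bar>f x l - f y l\<bar>) \<le> C * d x y"
      using C by (intro mult_left_mono) (simp_all add: d_def)
    then show ?thesis using lip[OF that] by linarith
  qed
  define r where "r x = f x n - (\<Sum>i<m. a i x * f (p i) n)" for x
  define R where "R = 1 + (\<Sum>i<m. C * \<bar>f (p i) n\<bar>)"
  have R: "0 \<le> R" using C by (simp add: R_def sum_nonneg add_nonneg_nonneg)
  have r_lip: "\<bar>r x - r y\<bar> \<le> R * d x y" if "x \<in> S" "y \<in> S" for x y
  proof -
    have "r x - r y = (f x n - f y n) - (\<Sum>i<m. (a i x - a i y) * f (p i) n)"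
      by (simp add: r_def left_diff_distrib sum_subtractf)
    then have "\<bar>r x - r y\<bar> \<le> \<bar>f x n - f y n\<bar> + \<bar>\<Sum>i<m. (a i x - a i y) * f (p i) n\<bar>"
      by linarith
    also have "\<bar>f x n - f y n\<bar> \<le> 1 * d x y" by (simp add: d_def sum_nonneg)
    also have "\<bar>\<Sum>i<m. (a i x - a i y) * f (p i) n\<bar> \<le> (\<Sum>i<m. C * d x y * \<bar>f (p i) n\<bar>)"
      using lip'[OF _ that] by (intro order_trans[OF sum_abs] sum_mono) (auto simp: abs_mult intro: mult_right_mono)
    also have "\<dots> = (\<Sum>i<m. C * \<bar>f (p i) n\<bar>) * d x y"
      unfolding sum_distrib_right by (rule sum.cong) (simp_all add: mult_ac)
    finally show ?thesis by (simp add: R_def distrib_right)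
  qed
  show ?case
  proof (cases "\<exists>w\<in>S. r w \<noteq> 0")
    case False
    have "f x j = (\<Sum>i<m. a i x * f (p i) j)" if "x \<in> S" "j < Suc n" for x j
      using a that False by (cases "j = n") (auto simp: r_def)
    then show ?thesis using C p lip' unfolding d_def by blast
  next
    case True
    then obtain w where w: "w \<in> S" "r w \<noteq> 0" by blast
    define q where "q i = (if i = m then w else p i)" for i
    define b where "b i x = (if i = m then r x / r w else a i x - a i w * (r x / r w))" for i x
    define c where "c = R / \<bar>r w\<bar>"
    define D where "D = c + C + (\<Sum>i<m. \<bar>a i w\<bar>) * c"
    have c: "0 \<le> c" using R by (simp add: c_def)
    have sum0: "0 \<le> (\<Sum>i<m. \<bar>a i w\<bar>)" by (simp add: sum_nonneg)
    have D: "0 \<le> D" using C c sum0 by (simp add: D_def)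
    have quot: "\<bar>r x / r w - r y / r w\<bar> \<le> c * d x y" if "x \<in> S" "y \<in> S" for x y
      using r_lip[OF that] w(2)
      by (simp add: c_def divide_right_mono flip: diff_divide_distrib)
    have "f x j = (\<Sum>i<Suc m. b i x * f (q i) j)" if x: "x \<in> S" and j: "j < Suc n" for x j
    proof -
      have "(\<Sum>i<Suc m. b i x * f (q i) j) =
          (\<Sum>i<m. (a i x - a i w * (r x / r w)) * f (p i) j) + r x / r w * f w j"
        by (simp add: b_def q_def)
      also have "(\<Sum>i<m. (a i x - a i w * (r x / r w)) * f (p i) j) =
          (\<Sum>i<m. a i x * f (p i) j) - r x / r w * (\<Sum>i<m. a i w * f (p i) j)"
        unfolding sum_distrib_left sum_subtractf[symmetric]
        by (rule sum.cong) (simp_all add: algebra_simps)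
      also have "\<dots> + r x / r w * f w j = f x j"
      proof (cases "j = n")
        case True
        have "(\<Sum>i<m. a i x * f (p i) j) = f x n - r x" "(\<Sum>i<m. a i w * f (p i) j) = f w n - r w"
          using True by (simp_all add: r_def)
        then show ?thesis using w(2) True by (simp add: right_diff_distrib)
      next
        case False
        then have "j < n" using j by simp
        then show ?thesis using a[OF x, of j] a[OF w(1), of j] by simp
      qed
      finally show ?thesis by simp
    qed
    moreover have "\<bar>b i x - b i y\<bar> \<le> D * d x y" if i: "i < Suc m" and xy: "x \<in> S" "y \<in> S" for i x y
    proof (cases "i = m")
      case True
      have "c * d x y \<le> D * d x y"
        using C c sum0 d0 by (intro mult_right_mono) (auto simp: D_def)
      then show ?thesis using quot[OF xy] True by (simp add: b_def)
    next
      case False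
      then have i: "i < m" using i by simp
      have "b i x - b i y = (a i x - a i y) - a i w * (r x / r w - r y / r w)"
        using False by (simp add: b_def right_diff_distrib)
      then have "\<bar>b i x - b i y\<bar> \<le> \<bar>a i x - a i y\<bar> + \<bar>a i w\<bar> * \<bar>r x / r w - r y / r w\<bar>"
        by (metis abs_mult abs_triangle_ineq4)
      also have "\<dots> \<le> C * d x y + \<bar>a i w\<bar> * (c * d x y)"
        using lip'[OF i xy] quot[OF xy] by (intro add_mono mult_left_mono) auto
      also have "\<dots> \<le> C * d x y + (\<Sum>i<m. \<bar>a i w\<bar>) * (c * d x y)"
        using i c d0 by (intro add_mono mult_right_mono member_le_sum) auto
      also have "\<dots> = (C + (\<Sum>i<m. \<bar>a i w\<bar>) * c) * d x y" by (simp add: distrib_right mult.assoc)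
      also have "\<dots> \<le> D * d x y"
        using c d0 by (intro mult_right_mono) (auto simp: D_def)
      finally show ?thesis .
    qed
    moreover have "q i \<in> S" if "i < Suc m" for i using that p w by (auto simp: q_def)
    ultimately show ?thesis using D unfolding d_def by blast
  qed
qed

context continuous_flow
begin

text \<open>
  By linearity the combination of spanning points that gives \<open>F x\<close> also gives \<open>F (\<Phi> t x)\<close> from the trajectories
  of the spanning points, with the same coefficients. There are finitely many of these trajectories, each bounded for
  \<open>t \<ge> 0\<close>, so the constant does not depend on \<open>t\<close>.
\<close>

lemma forward_bounded_linear_flow_lipschitz:
  fixes F :: "'a \<Rightarrow> nat \<Rightarrow> real" and n :: nat
  assumes lin: "\<forall>t. \<forall>x\<in>topspace X. \<forall>j<n. F (\<Phi> t x) j = (\<Sum>l<n. M t j l * F x l)"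
    and bdd: "\<forall>x\<in>topspace X. \<exists>B. \<forall>t\<ge>0. (\<Sum>j<n. \<bar>F (\<Phi> t x) j\<bar>) \<le> B"
  obtains L :: real where "0 \<le> L" "\<forall>t\<ge>0. \<forall>x\<in>topspace X. \<forall>y\<in>topspace X.
      (\<Sum>j<n. \<bar>F (\<Phi> t x) j - F (\<Phi> t y) j\<bar>) \<le> L * (\<Sum>j<n. \<bar>F x j - F y j\<bar>)"
proof -
  obtain m :: nat and p a C where spanning: "0 \<le> C \<and> (\<forall>i<m. p i \<in> topspace X) \<and>
      (\<forall>x\<in>topspace X. \<forall>j<n. F x j = (\<Sum>i<m. a i x * F (p i) j)) \<and>
      (\<forall>i<m. \<forall>x\<in>topspace X. \<forall>y\<in>topspace X. \<bar>a i x - a i y\<bar> \<le> C * (\<Sum>l<n. \<bar>F x l - F y l\<bar>))"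
    using finite_spanning_coordinates[of "topspace X" n F] by (elim exE) (rule that)
  have C: "0 \<le> C" and p: "\<And>i. i < m \<Longrightarrow> p i \<in> topspace X"
    and a: "\<And>x j. \<lbrakk>x \<in> topspace X; j < n\<rbrakk> \<Longrightarrow> F x j = (\<Sum>i<m. a i x * F (p i) j)"
    and lip: "\<And>i x y. \<lbrakk>i < m; x \<in> topspace X; y \<in> topspace X\<rbrakk> \<Longrightarrow>
        \<bar>a i x - a i y\<bar> \<le> C * (\<Sum>l<n. \<bar>F x l - F y l\<bar>)"
    using spanning by blast+
  have "\<forall>i\<in>{..<m}. \<exists>B. \<forall>t\<ge>0. (\<Sum>j<n. \<bar>F (\<Phi> t (p i)) j\<bar>) \<le> B"
    using bdd p by blast
  then obtain B where "\<forall>i\<in>{..<m}. \<forall>t\<ge>0. (\<Sum>j<n. \<bar>F (\<Phi> t (p i)) j\<bar>) \<le> B i"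
    by (rule bchoice[THEN exE])
  then have B: "(\<Sum>j<n. \<bar>F (\<Phi> t (p i)) j\<bar>) \<le> B i" if "i < m" "0 \<le> t" for i t
    using that by blast
  have expand: "F (\<Phi> t x) j = (\<Sum>i<m. a i x * F (\<Phi> t (p i)) j)" if x: "x \<in> topspace X" and j: "j < n" for t x j
  proof -
    have "F (\<Phi> t x) j = (\<Sum>l<n. M t j l * (\<Sum>i<m. a i x * F (p i) l))"
      using lin x j a by simp
    also have "\<dots> = (\<Sum>i<m. a i x * (\<Sum>l<n. M t j l * F (p i) l))"
      unfolding sum_distrib_left by (subst sum.swap) (simp add: mult_ac)
    also have "\<dots> = (\<Sum>i<m. a i x * F (\<Phi> t (p i)) j)"
      using lin p j by simp
    finally show ?thesis .
  qed
  show ?thesis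
  proof (rule that[of "\<Sum>i<m. C * \<bar>B i\<bar>"])
    show "0 \<le> (\<Sum>i<m. C * \<bar>B i\<bar>)" using C by (simp add: sum_nonneg)
    show "\<forall>t\<ge>0. \<forall>x\<in>topspace X. \<forall>y\<in>topspace X.
      (\<Sum>j<n. \<bar>F (\<Phi> t x) j - F (\<Phi> t y) j\<bar>) \<le> (\<Sum>i<m. C * \<bar>B i\<bar>) * (\<Sum>j<n. \<bar>F x j - F y j\<bar>)"
    proof (intro allI impI ballI)
      fix t :: real and x y assume t: "0 \<le> t" and xy: "x \<in> topspace X" "y \<in> topspace X"
      let ?d = "\<Sum>j<n. \<bar>F x j - F y j\<bar>"
      have "(\<Sum>j<n. \<bar>F (\<Phi> t x) j - F (\<Phi> t y) j\<bar>) = (\<Sum>j<n. \<bar>\<Sum>i<m. (a i x - a i y) * F (\<Phi> t (p i)) j\<bar>)"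
        using xy by (simp add: expand left_diff_distrib sum_subtractf)
      also have "\<dots> \<le> (\<Sum>j<n. \<Sum>i<m. \<bar>a i x - a i y\<bar> * \<bar>F (\<Phi> t (p i)) j\<bar>)"
        by (intro sum_mono order_trans[OF sum_abs]) (simp add: abs_mult)
      also have "\<dots> = (\<Sum>i<m. \<bar>a i x - a i y\<bar> * (\<Sum>j<n. \<bar>F (\<Phi> t (p i)) j\<bar>))"
        by (subst sum.swap) (simp add: sum_distrib_left)
      also have "\<dots> \<le> (\<Sum>i<m. (C * ?d) * \<bar>B i\<bar>)"
      proof (intro sum_mono mult_mono)
        fix i assume i: "i \<in> {..<m}"
        then show "\<bar>a i x - a i y\<bar> \<le> C * ?d" using lip xy by simp
        show "(\<Sum>j<n. \<bar>F (\<Phi> t (p i)) j\<bar>) \<le> \<bar>B i\<bar>" using B[of i t] i t by simp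
      qed (use C in \<open>auto simp: sum_nonneg\<close>)
      also have "\<dots> = (\<Sum>i<m. C * \<bar>B i\<bar>) * ?d"
        by (simp add: sum_distrib_right mult_ac)
      finally show "(\<Sum>j<n. \<bar>F (\<Phi> t x) j - F (\<Phi> t y) j\<bar>) \<le> (\<Sum>i<m. C * \<bar>B i\<bar>) * ?d" .
    qed
  qed
qed

text \<open>
  The phase is \<open>P x = lim (\<lambda>k. \<Phi> (k * T) x)\<close> for a period \<open>T\<close>. The common Lipschitz constant \<open>L\<close> gives
  convergence (once an iterate is close to a point of \<open>A\<close>, which is fixed by \<open>\<Phi> T\<close>, all later ones are) and
  continuity of the limit.
\<close>

proposition linearizable_imp_asymptotic_phase:
  assumes periodic: "periodic_orbit_image X \<Phi> A"
    and attracting: "\<forall>x\<in>topspace X. \<forall>U. set_nhd X A U \<longrightarrow> (\<forall>\<^sub>F t in at_top. \<Phi> t x \<in> U)"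
    and linearizing: "linearizing X \<Phi> n F" and emb: "embedding_map X (Euclidean_space n) F"
  shows "has_C0_asymptotic_phase X \<Phi> A"
proof -
  obtain x0 T where x0: "x0 \<in> topspace X" and T: "0 < T" and per: "\<And>t. \<Phi> (t + T) x0 = \<Phi> t x0"
    and A: "A = range (\<lambda>t. \<Phi> t x0)"
    using periodic unfolding periodic_orbit_image_def by metis
  have A_compact: "compactin X A" unfolding A by (rule periodic_orbit_compact[OF x0 T per])
  have A_sub: "A \<subseteq> topspace X" using A x0 by auto
  have A_ne: "A \<noteq> {}" using A by simp
  have A_inv: "\<Phi> t a \<in> A" if "a \<in> A" for t a using that x0 by (auto simp: A flow_add)
  have A_per: "\<Phi> (of_nat k * T) a = a" if a: "a \<in> A" for k a
  proof -
    obtain t where t: "a = \<Phi> t x0" using a A by auto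
    have "\<Phi> (of_nat k * T) a = \<Phi> t (\<Phi> (of_nat k * T) x0)"
      using x0 t by (simp add: flow_add add.commute)
    then show ?thesis using periodic_multiple[OF x0 per] t by simp
  qed
  have F_in: "F x \<in> topspace (Euclidean_space n)" if "x \<in> topspace X" for x
    using linearizing that unfolding linearizing_def by blast
  have hom: "homeomorphic_map X (subtopology (Euclidean_space n) (F ` topspace X)) F"
    using emb by (simp add: embedding_map_def)
  have F_cont: "continuous_map X (Euclidean_space n) F"
    using homeomorphic_imp_continuous_map[OF hom] by (simp add: continuous_map_in_subtopology)
  have Fj: "continuous_map X euclideanreal (\<lambda>x. F x j)" for j
    using F_cont unfolding Euclidean_space_def continuous_map_in_subtopology continuous_map_componentwise_UNIV by blast
  have F_inj: "x = y" if "x \<in> topspace X" "y \<in> topspace X" "\<And>j. j < n \<Longrightarrow> F x j = F y j" for x y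
  proof -
    have "F x j = F y j" for j
      using F_in[OF that(1)] F_in[OF that(2)] that(3) by (cases "j < n") (auto simp: topspace_Euclidean_space)
    then have "F x = F y" by blast
    then show ?thesis using homeomorphic_imp_injective_map[OF hom] that by (auto simp: inj_on_def)
  qed
  obtain M where M: "\<forall>t. \<forall>x\<in>topspace X. \<forall>j<n. F (\<Phi> t x) j = (\<Sum>l<n. M t j l * F x l)"
  proof -
    obtain B where B: "B \<in> carrier_mat n n"
      "\<And>t x. x \<in> topspace X \<Longrightarrow> vec n (F (\<Phi> t x)) = mat_exp (t \<cdot>\<^sub>m B) *\<^sub>v vec n (F x)"
      using linearizing unfolding linearizing_def by blast
    have dims: "dim_row (mat_exp (t \<cdot>\<^sub>m B)) = n" "dim_col (mat_exp (t \<cdot>\<^sub>m B)) = n" for t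
      using B(1) by (auto simp: mat_exp_def)
    have "F (\<Phi> t x) j = (\<Sum>l<n. mat_exp (t \<cdot>\<^sub>m B) $$ (j, l) * F x l)" if "x \<in> topspace X" "j < n" for t x j
    proof -
      have "F (\<Phi> t x) j = (mat_exp (t \<cdot>\<^sub>m B) *\<^sub>v vec n (F x)) $ j"
        using B(2)[OF that(1), of t] that(2) by (metis index_vec)
      then show ?thesis using that(2) dims by (simp add: scalar_prod_def atLeast0LessThan)
    qed
    then show ?thesis using that[of "\<lambda>t j l. mat_exp (t \<cdot>\<^sub>m B) $$ (j, l)"] by blast
  qed
  define d where "d x y = (\<Sum>j<n. \<bar>F x j - F y j\<bar>)" for x y
  have d_cont: "continuous_map X euclideanreal (d x)" for x
    unfolding d_def by (intro continuous_intros Fj) auto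
  have bdd: "\<exists>B. \<forall>t\<ge>0. (\<Sum>j<n. \<bar>F (\<Phi> t x) j\<bar>) \<le> B" if x: "x \<in> topspace X" for x
  proof -
    define N where "N y = (\<Sum>j<n. \<bar>F y j\<bar>)" for y
    have N: "continuous_map X euclideanreal N" unfolding N_def by (intro continuous_intros Fj) auto
    then have "compact (N ` A)" using image_compactin[OF A_compact N] by (simp add: compactin_euclidean_iff)
    then obtain c where c: "\<And>a. a \<in> A \<Longrightarrow> \<bar>N a\<bar> \<le> c"
      using compact_imp_bounded bounded_real by (metis imageI)
    then have "A \<subseteq> {y \<in> topspace X. N y < c + 1}" using A_sub by fastforce
    then have "set_nhd X A {y \<in> topspace X. N y < c + 1}"
      using openin_real_less[OF N] by (intro set_nhd_openI)
    then have "\<forall>\<^sub>F t in at_top. \<Phi> t x \<in> {y \<in> topspace X. N y < c + 1}"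
      using attracting x by blast
    then obtain t0 where t0: "\<And>t. t0 \<le> t \<Longrightarrow> N (\<Phi> t x) < c + 1"
      by (auto simp: eventually_at_top_linorder)
    have "continuous_on UNIV (\<lambda>t. N (\<Phi> t x))"
      using continuous_map_compose[OF orbit_continuous[OF x] N] by (simp add: o_def)
    then have "compact ((\<lambda>t. N (\<Phi> t x)) ` {0..t0})"
      by (meson compact_Icc compact_continuous_image continuous_on_subset top_greatest)
    then obtain b where b: "\<And>t. t \<in> {0..t0} \<Longrightarrow> \<bar>N (\<Phi> t x)\<bar> \<le> b"
      using compact_imp_bounded bounded_real by (metis imageI)
    have "N (\<Phi> t x) \<le> max b (c + 1)" if "0 \<le> t" for t
      using t0[of t] b[of t] that by (cases "t \<le> t0") auto
    then show ?thesis unfolding N_def by blast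
  qed
  then have "\<forall>x\<in>topspace X. \<exists>B. \<forall>t\<ge>0. (\<Sum>j<n. \<bar>F (\<Phi> t x) j\<bar>) \<le> B" by blast
  then obtain L where L: "0 \<le> L" and lip_all: "\<forall>t\<ge>0. \<forall>x\<in>topspace X. \<forall>y\<in>topspace X.
      (\<Sum>j<n. \<bar>F (\<Phi> t x) j - F (\<Phi> t y) j\<bar>) \<le> L * (\<Sum>j<n. \<bar>F x j - F y j\<bar>)"
    by (rule forward_bounded_linear_flow_lipschitz[OF M])
  have lip: "d (\<Phi> t x) (\<Phi> t y) \<le> L * d x y" if "0 \<le> t" "x \<in> topspace X" "y \<in> topspace X" for t x y
    using lip_all that unfolding d_def by blast
  have coord_le: "\<bar>F x j - F y j\<bar> \<le> d x y" if "j < n" for x y j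
    unfolding d_def using that by (intro member_le_sum) auto
  define s where "s x k = \<Phi> (of_nat k * T) x" for x k
  have s_in: "s x k \<in> topspace X" if "x \<in> topspace X" for x k using that by (simp add: s_def)
  have near: "\<exists>a\<in>A. \<exists>k0. \<forall>k\<ge>k0. d (s x k) a < e" if x: "x \<in> topspace X" and e: "0 < e" for x e
  proof -
    \<comment> \<open>Enlarging \<open>L\<close> by \<open>1\<close> avoids a division by \<open>0\<close> and makes the final bound strict.\<close>
    define e' where "e' = e / (L + 1)"
    have e': "0 < e'" using e L by (simp add: e'_def)
    define U where "U = (\<Union>a\<in>A. {y \<in> topspace X. d a y < e'})"
    have "openin X U" unfolding U_def using openin_real_less(1)[OF d_cont] by blast
    moreover have "A \<subseteq> U" using A_sub e' by (auto simp: U_def d_def)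
    ultimately have "\<forall>\<^sub>F t in at_top. \<Phi> t x \<in> U" using attracting x set_nhd_openI by blast
    then obtain t0 where t0: "\<And>t. t0 \<le> t \<Longrightarrow> \<Phi> t x \<in> U" by (auto simp: eventually_at_top_linorder)
    obtain k0 where "t0 < of_nat k0 * T" using ex_less_of_nat_mult T by blast
    then have "s x k0 \<in> U" using t0 by (simp add: s_def)
    then obtain a where a: "a \<in> A" "d a (s x k0) < e'" by (auto simp: U_def)
    have "d (s x k) a < e" if "k0 \<le> k" for k
    proof -
      have "of_nat (k - k0) * T + of_nat k0 * T = of_nat k * T" using that by (simp add: left_diff_distrib)
      then have "s x k = \<Phi> (of_nat (k - k0) * T) (s x k0)" using x by (simp add: s_def flow_add)
      moreover have "a = \<Phi> (of_nat (k - k0) * T) a" using A_per[OF a(1)] by simp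
      ultimately have "d (s x k) a \<le> L * d (s x k0) a"
        using lip[of "of_nat (k - k0) * T" "s x k0" a] T s_in[OF x] a(1) A_sub by auto
      also have "\<dots> \<le> L * e'" using a(2) L by (intro mult_left_mono) (simp_all add: d_def abs_minus_commute)
      also have "\<dots> < (L + 1) * e'" using e' by simp
      also have "\<dots> = e" using L by (simp add: e'_def)
      finally show ?thesis .
    qed
    then show ?thesis using a(1) by blast
  qed
  have "\<exists>a\<in>A. \<forall>j<n. (\<lambda>k. F (s x k) j) \<longlonglongrightarrow> F a j" if x: "x \<in> topspace X" for x
  proof -
    have "convergent (\<lambda>k. F (s x k) j)" if j: "j < n" for j
    proof (rule Cauchy_convergent, rule metric_CauchyI)
      fix e :: real assume "0 < e"
      then obtain a k0 where "\<forall>k\<ge>k0. d (s x k) a < e / 2" using near[OF x, of "e / 2"] by auto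
      then have close: "\<bar>F (s x k) j - F a j\<bar> < e / 2" if "k0 \<le> k" for k
        using coord_le[OF j] that le_less_trans by blast
      have "dist (F (s x k) j) (F (s x l) j) < e" if "k0 \<le> k" "k0 \<le> l" for k l
        using close[OF that(1)] close[OF that(2)] unfolding dist_real_def by linarith
      then show "\<exists>K. \<forall>k\<ge>K. \<forall>l\<ge>K. dist (F (s x k) j) (F (s x l) j) < e" by blast
    qed
    then obtain G where G: "\<And>j. j < n \<Longrightarrow> (\<lambda>k. F (s x k) j) \<longlonglongrightarrow> G j"
      unfolding convergent_def by metis
    \<comment> \<open>The coordinatewise limit \<open>G\<close> is attained on \<open>A\<close>: its distance to \<open>F a\<close> attains its minimum over the compact
        set \<open>A\<close>, and the minimum is \<open>0\<close> since the iterates approach \<open>A\<close>.\<close>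
    define \<delta> where "\<delta> a = (\<Sum>j<n. \<bar>F a j - G j\<bar>)" for a
    have "continuous_map X euclideanreal \<delta>" unfolding \<delta>_def by (intro continuous_intros Fj) auto
    from image_compactin[OF A_compact this] have "compact (\<delta> ` A)" by (simp add: compactin_euclidean_iff)
    then obtain a where a: "a \<in> A" "\<And>b. b \<in> A \<Longrightarrow> \<delta> a \<le> \<delta> b"
      using compact_attains_inf[of "\<delta> ` A"] A_ne by auto
    have "\<delta> a \<le> e" if "0 < e" for e
    proof -
      obtain b k0 where b: "b \<in> A" "\<And>k. k0 \<le> k \<Longrightarrow> d (s x k) b < e"
        using near[OF x \<open>0 < e\<close>] by blast
      have "(\<lambda>k. \<Sum>j<n. \<bar>F b j - F (s x k) j\<bar>) \<longlonglongrightarrow> (\<Sum>j<n. \<bar>F b j - G j\<bar>)"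
        using G by (intro tendsto_intros) auto
      moreover have "\<forall>k\<ge>k0. (\<Sum>j<n. \<bar>F b j - F (s x k) j\<bar>) \<le> e"
        using b(2) by (fastforce simp: d_def abs_minus_commute)
      ultimately have "\<delta> b \<le> e" unfolding \<delta>_def by (meson LIMSEQ_le_const2)
      then show ?thesis using a(2)[OF b(1)] by linarith
    qed
    then have "\<delta> a \<le> 0" by (simp add: field_le_epsilon)
    moreover have "\<bar>F a j - G j\<bar> \<le> \<delta> a" if "j < n" for j
      unfolding \<delta>_def using that by (intro member_le_sum) auto
    ultimately have "F a j = G j" if "j < n" for j using that by fastforce
    then have "(\<lambda>k. F (s x k) j) \<longlonglongrightarrow> F a j" if "j < n" for j using G that by metis
    then show ?thesis using a(1) by blast
  qed
  then have "\<forall>x\<in>topspace X. \<exists>a. a \<in> A \<and> (\<forall>j<n. (\<lambda>k. F (s x k) j) \<longlonglongrightarrow> F a j)" by blast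
  then obtain P where P_all: "\<forall>x\<in>topspace X. P x \<in> A \<and> (\<forall>j<n. (\<lambda>k. F (s x k) j) \<longlonglongrightarrow> F (P x) j)"
    by (rule bchoice[THEN exE])
  have P_A: "P x \<in> A" if "x \<in> topspace X" for x using P_all that by blast
  have P: "(\<lambda>k. F (s x k) j) \<longlonglongrightarrow> F (P x) j" if "x \<in> topspace X" "j < n" for x j
    using P_all that by blast
  have P_X: "P x \<in> topspace X" if "x \<in> topspace X" for x using P_A that A_sub by blast
  have "P a = a" if "a \<in> A" for a
  proof (rule F_inj)
    show "P a \<in> topspace X" "a \<in> topspace X" using that A_sub P_X by auto
    then show "F (P a) j = F a j" if "j < n" for j
      using P[of a j] that A_per[OF \<open>a \<in> A\<close>] by (simp add: s_def LIMSEQ_const_iff)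
  qed
  moreover have "P (\<Phi> t x) = \<Phi> t (P x)" if x: "x \<in> topspace X" for t x
  proof (rule F_inj)
    show "P (\<Phi> t x) \<in> topspace X" "\<Phi> t (P x) \<in> topspace X" using x P_X by auto
    fix j assume j: "j < n"
    have "s (\<Phi> t x) k = \<Phi> t (s x k)" for k using x by (simp add: s_def flow_add add.commute)
    then have "(\<lambda>k. F (s (\<Phi> t x) k) j) = (\<lambda>k. \<Sum>l<n. M t j l * F (s x k) l)"
      using M s_in[OF x] j by simp
    moreover have "\<dots> \<longlonglongrightarrow> (\<Sum>l<n. M t j l * F (P x) l)"
      using P[OF x] by (intro tendsto_intros) auto
    moreover have "(\<Sum>l<n. M t j l * F (P x) l) = F (\<Phi> t (P x)) j"
      using M P_X[OF x] j by simp
    ultimately have "(\<lambda>k. F (s (\<Phi> t x) k) j) \<longlonglongrightarrow> F (\<Phi> t (P x)) j" by simp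
    then show "F (P (\<Phi> t x)) j = F (\<Phi> t (P x)) j"
      using LIMSEQ_unique[OF P[OF flow_in[OF x] j]] by blast
  qed
  moreover have "continuous_map X (subtopology X A) P"
  proof -
    \<comment> \<open>Since \<open>F\<close> is an embedding, continuity of \<open>P\<close> may be checked on the coordinates of \<open>F \<circ> P\<close>.\<close>
    have lipP: "\<bar>F (P x) j - F (P y) j\<bar> \<le> L * d x y" if "x \<in> topspace X" "y \<in> topspace X" "j < n" for x y j
    proof -
      have "(\<lambda>k. \<bar>F (s x k) j - F (s y k) j\<bar>) \<longlonglongrightarrow> \<bar>F (P x) j - F (P y) j\<bar>"
        using P that by (intro tendsto_intros) auto
      moreover have "\<bar>F (s x k) j - F (s y k) j\<bar> \<le> L * d x y" for k
      proof -
        have "d (s x k) (s y k) \<le> L * d x y" unfolding s_def using T that by (intro lip) auto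
        then show ?thesis using coord_le[OF that(3)] order_trans by blast
      qed
      ultimately show ?thesis by (meson LIMSEQ_le_const2)
    qed
    have "continuous_map X euclideanreal (\<lambda>x. F (P x) j)" if j: "j < n" for j
    proof (rule continuous_map_eps_nhdI)
      fix x and e :: real assume x: "x \<in> topspace X" and e: "0 < e"
      let ?U = "{y \<in> topspace X. d x y < e / (L + 1)}"
      have "dist (F (P x) j) (F (P y) j) < e" if "y \<in> ?U" for y
      proof -
        have "\<bar>F (P x) j - F (P y) j\<bar> \<le> L * d x y" using lipP x that j by simp
        also have "\<dots> \<le> L * (e / (L + 1))" using that L by (intro mult_left_mono) auto
        also have "\<dots> < e" using L e by (simp add: field_simps)
        finally show ?thesis by (simp add: dist_real_def)
      qed
      moreover have "openin X ?U" by (rule openin_real_less(1)[OF d_cont])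
      moreover have "x \<in> ?U" using x e L by (simp add: d_def)
      ultimately show "\<exists>U. openin X U \<and> x \<in> U \<and> (\<forall>y\<in>U. dist (F (P x) j) (F (P y) j) < e)" by blast
    qed
    then have "continuous_map X (Euclidean_space n) (\<lambda>x i. if i < n then F (P x) i else 0)"
      by (simp add: continuous_map_componentwise_Euclidean_space)
    then have "continuous_map X (Euclidean_space n) (F \<circ> P)"
      by (rule continuous_map_eq) (use F_in P_X in \<open>auto simp: topspace_Euclidean_space\<close>)
    then have FP: "continuous_map X (subtopology (Euclidean_space n) (F ` topspace X)) (F \<circ> P)"
      using P_X by (auto simp: continuous_map_in_subtopology)
    obtain g where g: "homeomorphic_maps X (subtopology (Euclidean_space n) (F ` topspace X)) F g"
      using hom homeomorphic_map_maps by blast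
    then have "continuous_map X X (g \<circ> (F \<circ> P))"
      using continuous_map_compose[OF FP] unfolding homeomorphic_maps_def by blast
    then have "continuous_map X X P"
      by (rule continuous_map_eq) (use g P_X in \<open>auto simp: homeomorphic_maps_def\<close>)
    then show ?thesis using P_A by (auto simp: continuous_map_in_subtopology)
  qed
  ultimately show ?thesis unfolding has_C0_asymptotic_phase_def by blast
qed

end

section \<open>The exponential of a rotation block and a scalar block\<close>

text \<open>
  The complex number \<open>a\<close> acts on the first two coordinates, identified with the complex plane, and the real number
  \<open>b\<close> scales the others. For \<open>n \<ge> 2\<close> this is a homomorphism in \<open>(a, b)\<close>, so powers and the exponential
  are computed in the two scalar factors.
\<close>

definition rotation_scaling_mat :: "nat \<Rightarrow> complex \<Rightarrow> real \<Rightarrow> real mat" where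
  "rotation_scaling_mat n a b = mat n n (\<lambda>(i, j).
     if i < 2 \<and> j < 2 then (if i = j then Re a else if i = 0 then - Im a else Im a)
     else if i = j then b else 0)"

lemma rotation_scaling_mat_carrier [simp]:
  "rotation_scaling_mat n a b \<in> carrier_mat n n"
  "dim_row (rotation_scaling_mat n a b) = n" "dim_col (rotation_scaling_mat n a b) = n"
  by (simp_all add: rotation_scaling_mat_def)

lemma rotation_scaling_mat_mult_vec:
  assumes v: "dim_vec v = n" and n: "2 \<le> n" and i: "i < n"
  shows "(rotation_scaling_mat n a b *\<^sub>v v) $ i =
    (if i = 0 then Re a * v $ 0 - Im a * v $ 1 else if i = 1 then Im a * v $ 0 + Re a * v $ 1 else b * v $ i)"
proof -
  have "(rotation_scaling_mat n a b *\<^sub>v v) $ i = (\<Sum>j<n. rotation_scaling_mat n a b $$ (i, j) * v $ j)"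
    using i v by (simp add: scalar_prod_def atLeast0LessThan)
  also have "\<dots> = (\<Sum>j\<in>{0, 1, i}. rotation_scaling_mat n a b $$ (i, j) * v $ j)"
    using n i by (intro sum.mono_neutral_right) (auto simp: rotation_scaling_mat_def)
  also have "\<dots> = (if i = 0 then Re a * v $ 0 - Im a * v $ 1 else if i = 1 then Im a * v $ 0 + Re a * v $ 1 else b * v $ i)"
  proof -
    have "{0, 1, 0} = {0, 1::nat}" "{0, 1, 1} = {0, 1::nat}" by auto
    moreover have "i = 0 \<or> i = 1 \<or> 2 \<le> i" by linarith
    ultimately show ?thesis using n i by (auto simp: rotation_scaling_mat_def)
  qed
  finally show ?thesis .
qed

lemma rotation_scaling_mat_mult:
  assumes n: "2 \<le> n"
  shows "rotation_scaling_mat n a b * rotation_scaling_mat n c d = rotation_scaling_mat n (a * c) (b * d)"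
proof (rule eq_matI)
  fix i j assume "i < dim_row (rotation_scaling_mat n (a * c) (b * d))" "j < dim_col (rotation_scaling_mat n (a * c) (b * d))"
  then have ij: "i < n" "j < n" by simp_all
  have "(rotation_scaling_mat n a b * rotation_scaling_mat n c d) $$ (i, j) =
      (rotation_scaling_mat n a b *\<^sub>v col (rotation_scaling_mat n c d) j) $ i"
    using ij by simp
  also have "\<dots> = rotation_scaling_mat n (a * c) (b * d) $$ (i, j)"
    using ij n by (subst rotation_scaling_mat_mult_vec) (auto simp: rotation_scaling_mat_def)
  finally show "(rotation_scaling_mat n a b * rotation_scaling_mat n c d) $$ (i, j) =
      rotation_scaling_mat n (a * c) (b * d) $$ (i, j)" .
qed auto

lemma rotation_scaling_mat_power:
  assumes "2 \<le> n"
  shows "rotation_scaling_mat n a b ^\<^sub>m k = rotation_scaling_mat n (a ^ k) (b ^ k)"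
proof (induction k)
  case 0
  show ?case by (auto simp: rotation_scaling_mat_def)
next
  case (Suc k)
  then show ?case using assms by (simp add: rotation_scaling_mat_mult mult.commute)
qed

lemma mat_exp_rotation_scaling_mat:
  assumes n: "2 \<le> n"
  shows "mat_exp (rotation_scaling_mat n a b) = rotation_scaling_mat n (exp a) (exp b)"
proof (rule eq_matI)
  fix i j assume "i < dim_row (rotation_scaling_mat n (exp a) (exp b))" "j < dim_col (rotation_scaling_mat n (exp a) (exp b))"
  then have ij: "i < n" "j < n" by simp_all
  have a: "(\<lambda>k. a ^ k / fact k) sums exp a"
    using exp_converges[of a] by (simp add: scaleR_conv_of_real divide_inverse mult.commute)
  have b: "(\<lambda>k. b ^ k / fact k) sums exp b"
    using exp_converges[of b] by (simp add: divide_inverse mult.commute)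
  have Re: "(\<lambda>k. Re (a ^ k) / fact k) sums Re (exp a)" and Im: "(\<lambda>k. Im (a ^ k) / fact k) sums Im (exp a)"
  proof -
    have "Re (z / fact k) = Re z / fact k" "Im (z / fact k) = Im z / fact k" for z k
      by (metis Re_divide_of_real of_real_fact) (metis Im_divide_of_real of_real_fact)
    then show "(\<lambda>k. Re (a ^ k) / fact k) sums Re (exp a)" "(\<lambda>k. Im (a ^ k) / fact k) sums Im (exp a)"
      using sums_Re[OF a] sums_Im[OF a] by simp_all
  qed
  have "(\<lambda>k. rotation_scaling_mat n (a ^ k) (b ^ k) $$ (i, j) / fact k) sums
      rotation_scaling_mat n (exp a) (exp b) $$ (i, j)"
    using ij Re Im sums_minus[OF Im] b
    by (cases "i < 2"; cases "j < 2"; cases "i = j"; cases "i = 0") (simp_all add: rotation_scaling_mat_def)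
  then show "mat_exp (rotation_scaling_mat n a b) $$ (i, j) = rotation_scaling_mat n (exp a) (exp b) $$ (i, j)"
    using ij n by (simp add: mat_exp_def rotation_scaling_mat_power sums_iff)
qed (simp_all add: mat_exp_def)

lemma smult_rotation_scaling_mat:
  "t \<cdot>\<^sub>m rotation_scaling_mat n a b = rotation_scaling_mat n (of_real t * a) (t * b)"
  by (rule eq_matI) (auto simp: rotation_scaling_mat_def)

section \<open>Linear coordinates from an asymptotic phase\<close>

context attractor
begin

text \<open>
  The embedding consists of \<open>\<theta> (P x)\<close>, rotating with frequency \<open>\<omega>\<close>, and the contracting coordinates. It is
  injective since the contracting coordinates separate points except on \<open>A\<close>, where \<open>P\<close> is the identity and \<open>\<theta>\<close>
  is injective. It is proper, hence closed, since the coordinate \<open>V\<close> has compact sublevel sets.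
\<close>

proposition asymptotic_phase_imp_linearizable:
  assumes sep: "\<And>K. compactin X K \<Longrightarrow> \<exists>\<G>. finite \<G> \<and> (\<forall>g\<in>\<G>. continuous_map (subtopology X K) euclideanreal g) \<and>
      (\<forall>x\<in>K. \<forall>y\<in>K. (\<forall>g\<in>\<G>. g x = g y) \<longrightarrow> x = y)"
    and \<theta>: "continuous_map (subtopology X A) euclidean (\<theta> :: 'a \<Rightarrow> complex)" "inj_on \<theta> A"
      "\<forall>t. \<forall>a\<in>A. \<theta> (\<Phi> t a) = cis (\<omega> * t) * \<theta> a"
    and phase: "has_C0_asymptotic_phase X \<Phi> A"
  shows "linearizable_by_C0_embedding X \<Phi>"
proof -
  obtain P where P: "continuous_map X (subtopology X A) P" "\<And>a. a \<in> A \<Longrightarrow> P a = a"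
      "\<And>t x. x \<in> topspace X \<Longrightarrow> P (\<Phi> t x) = \<Phi> t (P x)"
    using phase unfolding has_C0_asymptotic_phase_def by metis
  have P_A: "P x \<in> A" if "x \<in> topspace X" for x
    using continuous_map_funspace[OF P(1)] that by auto
  define z where "z x = \<theta> (P x)" for x
  have z: "continuous_map X euclidean z"
    using continuous_map_compose[OF P(1) \<theta>(1)] by (simp add: z_def[abs_def] o_def)
  have z_Re: "continuous_map X euclideanreal (\<lambda>x. Re (z x))" and z_Im: "continuous_map X euclideanreal (\<lambda>x. Im (z x))"
    using continuous_map_compose[OF z, of euclideanreal Re] continuous_map_compose[OF z, of euclideanreal Im]
    by (simp_all add: o_def continuous_on_Re continuous_on_Im continuous_on_id)
  have z_flow: "z (\<Phi> t x) = cis (\<omega> * t) * z x" if "x \<in> topspace X" for t x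
    using that P(3) P_A \<theta>(3) by (simp add: z_def)
  obtain \<Q> V where \<Q>: "finite \<Q>" "V \<in> \<Q>" "\<forall>q\<in>\<Q>. continuous_map X euclideanreal q"
    "\<forall>q\<in>\<Q>. \<forall>t. \<forall>x\<in>topspace X. q (\<Phi> t x) = exp (- t) * q x"
    "\<forall>x\<in>topspace X. \<forall>y\<in>topspace X. (\<forall>q\<in>\<Q>. q x = q y) \<longrightarrow> x = y \<or> x \<in> A \<and> y \<in> A"
    "\<forall>c. compactin X {x \<in> topspace X. V x \<le> c}"
    by (rule contracting_coordinates[OF sep])
  obtain e where e: "bij_betw e {0..<card \<Q>} \<Q>"
    using ex_bij_betw_nat_finite[OF \<Q>(1)] by blast
  define n where "n = card \<Q> + 2"
  have n: "2 \<le> n" by (simp add: n_def)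
  have e_in: "e (i - 2) \<in> \<Q>" if "2 \<le> i" "i < n" for i
    using bij_betwE[OF e] that by (simp add: n_def)
  have e_onto: "\<exists>i. 2 \<le> i \<and> i < n \<and> e (i - 2) = q" if "q \<in> \<Q>" for q
  proof -
    have "q \<in> e ` {0..<card \<Q>}" using e \<open>q \<in> \<Q>\<close> by (simp add: bij_betw_imp_surj_on)
    then obtain k where "k < card \<Q>" "e k = q" by auto
    then show ?thesis by (intro exI[of _ "k + 2"]) (simp add: n_def)
  qed
  \<comment> \<open>Coordinates \<open>0\<close> and \<open>1\<close> hold the complex number \<open>z x\<close>; the contracting coordinates follow, shifted by \<open>2\<close>.\<close>
  define coord where "coord x i = (if i = 0 then Re (z x) else if i = 1 then Im (z x) else e (i - 2) x)" for x and i :: nat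
  define F where "F x i = (if i < n then coord x i else 0)" for x and i :: nat
  have F_q: "F x i = e (i - 2) x" if "2 \<le> i" "i < n" for x i
    using that by (simp add: F_def coord_def)
  have F_z: "F x 0 = Re (z x)" "F x 1 = Im (z x)" for x
    using n by (simp_all add: F_def coord_def)
  have coord: "continuous_map X euclideanreal (\<lambda>x. coord x i)" if "i < n" for i
  proof (cases "2 \<le> i")
    case True
    then show ?thesis using e_in \<Q>(3) that by (simp add: coord_def)
  next
    case False
    then have "i = 0 \<or> i = 1" by linarith
    then show ?thesis using z_Re z_Im by (auto simp: coord_def)
  qed
  have F: "continuous_map X (Euclidean_space n) F"
    using coord unfolding F_def[abs_def] by (simp add: continuous_map_componentwise_Euclidean_space)
  have "linearizing X \<Phi> n F"
    unfolding linearizing_def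
  proof (intro conjI bexI allI ballI)
    show "F \<in> topspace X \<rightarrow> topspace (Euclidean_space n)"
      by (rule continuous_map_funspace[OF F])
    let ?B = "rotation_scaling_mat n (\<i> * of_real \<omega>) (- 1)"
    show "?B \<in> carrier_mat n n" by simp
    fix t x assume x: "x \<in> topspace X"
    have "mat_exp (t \<cdot>\<^sub>m ?B) = rotation_scaling_mat n (cis (\<omega> * t)) (exp (- t))"
      using n by (simp add: smult_rotation_scaling_mat mat_exp_rotation_scaling_mat cis_conv_exp mult_ac)
    moreover have "vec n (F (\<Phi> t x)) = rotation_scaling_mat n (cis (\<omega> * t)) (exp (- t)) *\<^sub>v vec n (F x)"
    proof (rule eq_vecI)
      fix i assume "i < dim_vec (rotation_scaling_mat n (cis (\<omega> * t)) (exp (- t)) *\<^sub>v vec n (F x))"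
      then have i: "i < n" by simp
      have "i = 0 \<or> i = 1 \<or> 2 \<le> i" by linarith
      then show "vec n (F (\<Phi> t x)) $ i = (rotation_scaling_mat n (cis (\<omega> * t)) (exp (- t)) *\<^sub>v vec n (F x)) $ i"
      proof (elim disjE)
        assume "i = 0"
        then show ?thesis using i n x F_z
          by (subst rotation_scaling_mat_mult_vec) (simp_all add: z_flow)
      next
        assume "i = 1"
        then show ?thesis using i n x F_z
          by (subst rotation_scaling_mat_mult_vec) (simp_all add: z_flow)
      next
        assume "2 \<le> i"
        then show ?thesis using i n x e_in \<Q>(4)
          by (subst rotation_scaling_mat_mult_vec) (simp_all add: F_q)
      qed
    qed simp
    ultimately show "vec n (F (\<Phi> t x)) = mat_exp (t \<cdot>\<^sub>m ?B) *\<^sub>v vec n (F x)" by simp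
  qed
  moreover have "embedding_map X (Euclidean_space n) F"
  proof (rule injective_closed_imp_embedding_map[OF F])
    show "inj_on F (topspace X)"
    proof (rule inj_onI)
      fix x y assume x: "x \<in> topspace X" and y: "y \<in> topspace X" and eq: "F x = F y"
      have "q x = q y" if "q \<in> \<Q>" for q
        using e_onto[OF that] F_q eq by metis
      moreover have "z x = z y" using F_z eq by (metis complex_eqI)
      ultimately show "x = y"
        using \<Q>(5) x y P(2) inj_onD[OF \<theta>(2)] unfolding z_def by metis
    qed
    have "proper_map X (Euclidean_space n) F"
    proof (rule compact_imp_proper_map)
      show "k_space (Euclidean_space n)" by (rule metrizable_imp_k_space[OF metrizable_Euclidean_space])
      show "kc_space (Euclidean_space n)" by (rule Hausdorff_imp_kc_space[OF Hausdorff_Euclidean_space])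
      show "F \<in> topspace X \<rightarrow> topspace (Euclidean_space n)" by (rule continuous_map_funspace[OF F])
      show "continuous_map X (Euclidean_space n) F \<or> kc_space X" using F by blast
      fix C assume C: "compactin (Euclidean_space n) C"
      obtain i where i: "2 \<le> i" "i < n" "e (i - 2) = V" using e_onto \<Q>(2) by blast
      have "continuous_map (Euclidean_space n) euclideanreal (\<lambda>v. v i)"
        unfolding Euclidean_space_def by (intro continuous_map_from_subtopology continuous_map_product_projection) simp
      from image_compactin[OF C this] have "compact ((\<lambda>v. v i) ` C)"
        by (simp add: compactin_euclidean_iff)
      then obtain c where c: "\<And>v. v \<in> C \<Longrightarrow> \<bar>v i\<bar> \<le> c"
        using compact_imp_bounded bounded_real by (metis imageI)
      have "V x \<le> c" if "F x \<in> C" for x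
        using c[OF that] i F_q[of i x] by simp
      then have "{x \<in> topspace X. F x \<in> C} \<subseteq> {x \<in> topspace X. V x \<le> c}" by blast
      moreover have "closedin X {x \<in> topspace X. F x \<in> C}"
        using C compactin_imp_closedin[OF Hausdorff_Euclidean_space]
        by (intro closedin_continuous_map_preimage[OF F]) blast
      ultimately show "compactin X {x \<in> topspace X. F x \<in> C}"
        using \<Q>(6) closed_compactin by blast
    qed
    then show "closed_map X (Euclidean_space n) F" by (rule proper_imp_closed_map)
  qed
  ultimately show ?thesis unfolding linearizable_by_C0_embedding_def by blast
qed

end

section \<open>The equivalence\<close>

theorem corollary5:
  fixes X :: "'a topology" and M :: "'b topology" and S :: "'b set"
    and \<Phi> :: "real \<Rightarrow> 'a \<Rightarrow> 'a" and A :: "'a set"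
  assumes "locally_compact_space X"
    and "manifold M" and "S \<subseteq> topspace M" and "X homeomorphic_space subtopology M S"
    and "C0_flow X \<Phi>"
    and "periodic_orbit_image X \<Phi> A"
    and "globally_asymptotically_stable X \<Phi> A"
  shows "linearizable_by_C0_embedding X \<Phi> \<longleftrightarrow> has_C0_asymptotic_phase X \<Phi> A"
proof
  interpret continuous_flow X \<Phi> by unfold_locales (rule assms(5))
  assume "linearizable_by_C0_embedding X \<Phi>"
  then show "has_C0_asymptotic_phase X \<Phi> A"
    using linearizable_imp_asymptotic_phase assms(6,7)
    unfolding linearizable_by_C0_embedding_def globally_asymptotically_stable_def by blast
next
  interpret continuous_flow X \<Phi> by unfold_locales (rule assms(5))
  assume phase: "has_C0_asymptotic_phase X \<Phi> A"
  have Hausdorff: "Hausdorff_space X"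
    using assms(2,4) homeomorphic_Hausdorff_space Hausdorff_space_subtopology unfolding manifold_def by metis
  obtain x0 T where x0: "x0 \<in> topspace X" and T: "0 < T" and per: "\<And>t. \<Phi> (t + T) x0 = \<Phi> t x0"
    and A: "A = range (\<lambda>t. \<Phi> t x0)"
    using assms(6) unfolding periodic_orbit_image_def by metis
  interpret attractor X \<Phi> A
  proof
    show "compactin X A" unfolding A by (rule periodic_orbit_compact[OF x0 T per])
    show "\<Phi> t a \<in> A" if "a \<in> A" for t a using that x0 by (auto simp: A flow_add)
  qed (use assms Hausdorff in auto)
  obtain \<omega> and \<theta> :: "'a \<Rightarrow> complex" where "continuous_map (subtopology X A) euclidean \<theta>" "inj_on \<theta> A"
    "\<forall>t. \<forall>a\<in>A. \<theta> (\<Phi> t a) = cis (\<omega> * t) * \<theta> a"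
    by (rule periodic_orbit_circle_coordinate[OF Hausdorff x0 T per A])
  then show "linearizable_by_C0_embedding X \<Phi>"
    using manifold_subspace_compact_separating_functions[OF assms(2,4)] phase
    by (intro asymptotic_phase_imp_linearizable)
qed

end
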